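(* Let $E$ be an arbitrary subset of $\mathbb{R}^n$, $X\subset\mathbb{R}^n$ a linear subspace, $P:=P_X:\mathbb{R}^n\to X$ the orthogonal projection, and $f:E\to\mathbb{R}$, $G:E\to\mathbb{R}^n$ two functions. There exists a convex function $F:\mathbb{R}^n\to\mathbb{R}$ of class $C^1$ such that $F(x)=f(x)$ and $\nabla F(x)=G(x)$ for all $x\in E$, and $X_F=X$, if and only if the following conditions are satisfied. (i) $G$ is continuous and $f(x)\geq f(y)+\langle G(y),x-y\rangle$ for all $x,y\in E$. (ii) If $(x_k)_k\subset E$ is a sequence for which $\lim_{k\to\infty}|G(x_k)|=+\infty$, then $$\lim_{k\to\infty}\frac{\langle G(x_k),x_k\rangle-f(x_k)}{|G(x_k)|}=+\infty.$$ (iii) $Y:=\mathrm{span}\left(\{G(x)-G(y) : x,y\in E\}\right)\subseteq X$. (iv) If $Y\neq X$ and we denote $k=\dim Y$ and $d=\dim X$, there exist points $p_1,\ldots,p_{d-k}\in\mathbb{R}^n\setminus\overline{E}$, numbers $\beta_1,\ldots,\beta_{d-k}\in\mathbb{R}$, and vectors $w_1,\ldots,w_{d-k}\in\mathbb{R}^n$ such that: (a) $X=\mathrm{span}\left(\{u-v : u,v\in G(E)\cup\{w_1,\ldots,w_{d-k}\}\}\right)$; (b) $\beta_j>\max_{1\leq i\neq j\leq d-k}\{\beta_i+\langle w_i,p_j-p_i\rangle\}$ for all $1\leq j\leq d-k$; (c) $\beta_j>\sup_{z\in E,\,|G(z)|\leq N}\{f(z)+\langle G(z),p_j-z\rangle\}$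 for all $1\leq j\leq d-k$ and all $N\in\mathbb{N}$; (d) $\inf_{x\in E,\,|P(x)|\leq N}\left\{f(x)-\max_{1\leq j\leq d-k}\{\beta_j+\langle w_j,x-p_j\rangle\}\right\}>0$ for all $N\in\mathbb{N}$. (v) If $(x_k)_k,(z_k)_k$ are sequences in $E$ such that $(P(x_k))_k$ and $(G(z_k))_k$ are bounded and $$\lim_{k\to\infty}\left(f(x_k)-f(z_k)-\langle G(z_k),x_k-z_k\rangle\right)=0,$$ then $\lim_{k\to\infty}|G(x_k)-G(z_k)|=0$.
   Context: $\langle\cdot,\cdot\rangle$ and $|\cdot|$ denote the Euclidean inner product and norm on $\mathbb{R}^n$, and $\overline{E}$ is the closure of $E$. A maximum or supremum over an empty index set is $-\infty$, and an infimum over an empty index set is $+\infty$. For a linear subspace $X$ of $\mathbb{R}^n$, $P_X$ denotes the orthogonal projection onto $X$ and $X^{\perp}$ the orthogonal complement. A function $c:X\to\mathbb{R}$ is essentially coercive if there is a linear function $\ell:X\to\mathbb{R}$ such that $\lim_{k\to\infty}(c-\ell)(x_k)=\infty$ for every sequence $(x_k)_k\subset X$ with $|x_k|\to\infty$ (so every function on $\{0\}$ is essentially coercive). For a convex function $F:\mathbb{R}^n\to\mathbb{R}$, $X_F$ denotes the unique linear subspace of $\mathbb{R}^n$ for which there exist a vector $v_F\in X_F^{\perp}$ and an essentially coercive function $c_F:X_F\to\mathbb{R}$ such that $F(x)=c_F(P_{X_F}(x))+\langle v_F,x\rangle$ for all $x\in\mathbb{R}^n$ (it is a theorem that such $X_F,v_F,c_F$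 exist and are unique).
   Formalization: The case E empty with X ≠ {0} is excluded: there F(x)=|P(x)|^2 is a convex C^1 function with X_F=X, but (iv)(a) fails, since differences of d vectors span at most d−1 dimensions. *)

theory Defs
  imports "HOL-Analysis.Analysis"
begin

definition orth_proj :: "(real^'n) set \<Rightarrow> real^'n \<Rightarrow> real^'n" where
  "orth_proj X x = (THE y. y \<in> X \<and> x - y \<in> orthogonal_comp X)"

(* Only the values of c on X are relevant. The functional l is taken on the whole space:
   the linear functionals on a subspace X are exactly the restrictions of those. *)
definition essentially_coercive_on :: "(real^'n) set \<Rightarrow> (real^'n \<Rightarrow> real) \<Rightarrow> bool" where
  "essentially_coercive_on X c \<longleftrightarrow>
     (\<exists>l. linear l \<and>
        (\<forall>x. (\<forall>k. x k \<in> X) \<and> filterlim (\<lambda>k. norm (x k)) at_top sequentially \<longrightarrow>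
             filterlim (\<lambda>k. c (x k) - l (x k)) at_top sequentially))"

(* For convex F the subspace exists and is unique, which is a theorem and is not
   built into the definition; for other F the value may be unspecified. *)
definition coercivity_subspace :: "(real^'n \<Rightarrow> real) \<Rightarrow> (real^'n) set" where
  "coercivity_subspace F =
     (THE X. subspace X \<and>
        (\<exists>v c. v \<in> orthogonal_comp X \<and> essentially_coercive_on X c \<and>
               (\<forall>x. F x = c (orth_proj X x) + v \<bullet> x)))"

definition C1_function :: "(real^'n \<Rightarrow> real) \<Rightarrow> bool" where
  "C1_function F \<longleftrightarrow> (\<exists>DF. (\<forall>x. GDERIV F x :> DF x) \<and> continuous_on UNIV DF)"

end

theory Submission
  imports Defs
begin

text \<open>
  For a convex function \<open>F\<close> of class \<open>C\<^sup>1\<close> the subspace \<open>X\<^sub>F\<close> is the span of all differences of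
  gradients: \<open>F\<close> is affine with one fixed slope along the orthogonal complement of that span, and
  finitely many tangent planes whose gradient differences span it already force coercivity on it.
  Hence if the gradients on \<open>E\<close> do not span \<open>X\<close>, the points \<open>p\<^sub>j\<close> are points at which \<open>F\<close> has the
  missing gradients, and all gap conditions are instances of one compactness statement: when
  \<open>P x\<close> stays bounded and the tangent plane at \<open>z\<close> nearly touches \<open>F\<close> at \<open>x\<close>, the gradients at \<open>x\<close> and
  \<open>z\<close> are close.

  Conversely, after adding the \<open>p\<^sub>j\<close> to \<open>E\<close>, the supremum \<open>m\<close> of the prescribed tangent planes is a
  finite convex extension, differentiable at \<open>E\<close> locally uniformly. It lies below a function \<open>h\<close> that
  agrees with it on \<open>E\<close> and satisfies \<open>h (x + v) + h (x - v) - 2 h x \<le> \<epsilon> |v|\<close> for small \<open>v\<close>, locally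
  uniformly in \<open>x\<close>: \<open>h\<close> is the infimum of all paraboloids that lie above \<open>m\<close> and are based slightly above
  a point of \<open>E\<close> with the prescribed slope there, once a smooth function has been subtracted to
  make \<open>m\<close> bounded above. The one-sided second-difference bound passes to the convex envelope of \<open>h\<close>
  and makes it differentiable; being squeezed between \<open>m\<close> and \<open>h\<close>, the envelope has the
  prescribed jet on \<open>E\<close>.
\<close>

section \<open>Gradients of convex functions\<close>

lemma GDERIV_unique:
  assumes "GDERIV F x :> g" "GDERIV F x :> g'"
  shows "g = g'"
proof -
  have "(\<lambda>h. h \<bullet> g) = (\<lambda>h. h \<bullet> g')"
    using assms unfolding gderiv_def by (rule has_derivative_unique)
  then have "(g - g') \<bullet> g = (g - g') \<bullet> g'"
    by meson
  then have "(g - g') \<bullet> (g - g') = 0"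
    by (simp add: inner_diff_right)
  then show ?thesis
    by simp
qed

lemma GDERIV_eps:
  assumes "GDERIV F x :> g" "\<epsilon> > 0"
  shows "\<exists>\<delta>>0. \<forall>u. norm u \<le> \<delta> \<longrightarrow> \<bar>F (x + u) - F x - g \<bullet> u\<bar> \<le> \<epsilon> * norm u"
proof -
  have "(F has_derivative (\<lambda>h. h \<bullet> g)) (at x)"
    using assms(1) by (simp add: gderiv_def)
  then obtain d where "d > 0"
    and d: "\<And>y. norm (y - x) < d \<Longrightarrow> norm (F y - F x - (y - x) \<bullet> g) \<le> \<epsilon> * norm (y - x)"
    unfolding has_derivative_at_alt using \<open>\<epsilon> > 0\<close> by blast
  have "\<bar>F (x + u) - F x - g \<bullet> u\<bar> \<le> \<epsilon> * norm u" if "norm u \<le> d / 2" for u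
    using d[of "x + u"] that \<open>d > 0\<close> by (simp add: inner_commute)
  then show ?thesis
    using \<open>d > 0\<close> by (intro exI[of _ "d / 2"]) auto
qed

lemma GDERIV_I_eps:
  assumes "\<And>\<epsilon>. \<epsilon> > 0 \<Longrightarrow> \<exists>\<delta>>0. \<forall>u. norm u \<le> \<delta> \<longrightarrow> \<bar>F (x + u) - F x - g \<bullet> u\<bar> \<le> \<epsilon> * norm u"
  shows "GDERIV F x :> g"
  unfolding gderiv_def has_derivative_at_alt
proof (intro conjI allI impI)
  show "bounded_linear (\<lambda>h. h \<bullet> g)"
    by (rule bounded_linear_inner_left)
  fix e :: real assume "e > 0"
  then obtain d where "d > 0" and d: "\<And>u. norm u \<le> d \<Longrightarrow> \<bar>F (x + u) - F x - g \<bullet> u\<bar> \<le> e * norm u"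
    using assms by blast
  then show "\<exists>d>0. \<forall>y. norm (y - x) < d \<longrightarrow> norm (F y - F x - (y - x) \<bullet> g) \<le> e * norm (y - x)"
    using d[of "_ - x"] by (intro exI[of _ d]) (simp add: inner_commute)
qed

text \<open>Over the fraction \<open>t\<close> of the segment from \<open>x\<close> to
  \<open>y\<close>, convexity allows an increment of at most \<open>t * (F y - F x)\<close>, while
  the derivative gives \<open>t * (g \<bullet> w)\<close> up to a small multiple of
  \<open>t * norm w\<close>. Dividing by \<open>t\<close> leaves an arbitrarily small error.\<close>

lemma convex_on_GDERIV_ge:
  assumes "convex_on UNIV F" "GDERIV F x :> g"
  shows "F y \<ge> F x + g \<bullet> (y - x)"
proof (rule field_le_epsilon)
  fix e :: real assume "e > 0"
  define w where "w = y - x"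
  define \<epsilon> where "\<epsilon> = e / (norm w + 1)"
  have "\<epsilon> > 0" "\<epsilon> * norm w \<le> e"
    using \<open>e > 0\<close> by (auto simp: \<epsilon>_def field_simps add_pos_nonneg)
  obtain d where "d > 0" and d: "\<And>u. norm u \<le> d \<Longrightarrow> \<bar>F (x + u) - F x - g \<bullet> u\<bar> \<le> \<epsilon> * norm u"
    using GDERIV_eps[OF assms(2) \<open>\<epsilon> > 0\<close>] by blast
  define t where "t = min 1 (d / (norm w + 1))"
  have "norm w + 1 > 0"
    by (simp add: add_nonneg_pos)
  then have t: "0 < t" "t \<le> 1" using \<open>d > 0\<close> by (auto simp: t_def)
  have "t * norm w \<le> d / (norm w + 1) * norm w"
    by (intro mult_right_mono) (auto simp: t_def)
  also have "\<dots> \<le> d"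
    using \<open>d > 0\<close> by (simp add: field_simps add_pos_nonneg)
  finally have "\<bar>F (x + t *\<^sub>R w) - F x - g \<bullet> (t *\<^sub>R w)\<bar> \<le> \<epsilon> * (t * norm w)"
    using d[of "t *\<^sub>R w"] t by simp
  moreover have "F (x + t *\<^sub>R w) \<le> (1 - t) * F x + t * F y"
  proof -
    have "x + t *\<^sub>R w = (1 - t) *\<^sub>R x + t *\<^sub>R y"
      by (simp add: w_def algebra_simps)
    then show ?thesis
      using convex_onD[OF assms(1), of t x y] t by simp
  qed
  ultimately have "t * (g \<bullet> w) \<le> t * (F y - F x) + t * (\<epsilon> * norm w)"
    by (simp add: algebra_simps)
  then have "g \<bullet> w \<le> F y - F x + \<epsilon> * norm w"
    using t by (simp add: distrib_left[symmetric])
  then show "F x + g \<bullet> (y - x) \<le> F y + e"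
    using \<open>\<epsilon> * norm w \<le> e\<close> by (simp add: w_def)
qed

text \<open>A short step from \<open>x\<close> along \<open>h - g\<close> would lift the affine
  minorant of slope \<open>h\<close> above the first-order expansion with slope \<open>g\<close>.
  This is how the gradient of the extension is identified with \<open>G\<close>.\<close>

lemma GDERIV_eq_supporting:
  assumes "GDERIV F x :> g" and "\<And>y. F y \<ge> F x + h \<bullet> (y - x)"
  shows "h = g"
proof (rule ccontr)
  assume "h \<noteq> g"
  define n where "n = norm (h - g)"
  have "n > 0" using \<open>h \<noteq> g\<close> by (simp add: n_def)
  obtain d where "d > 0" and d: "\<And>u. norm u \<le> d \<Longrightarrow> \<bar>F (x + u) - F x - g \<bullet> u\<bar> \<le> n / 2 * norm u"
    using GDERIV_eps[OF assms(1), of "n / 2"] \<open>n > 0\<close> by auto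
  define u where "u = (d / n) *\<^sub>R (h - g)"
  have "norm u = d" using \<open>d > 0\<close> \<open>n > 0\<close> by (simp add: u_def n_def)
  have "(h - g) \<bullet> u = d * n"
    using \<open>n > 0\<close> by (simp add: u_def n_def dot_square_norm power2_eq_square)
  moreover have "(h - g) \<bullet> u \<le> n / 2 * d"
    using d[of u] assms(2)[of "x + u"] unfolding \<open>norm u = d\<close> inner_diff_left abs_le_iff by simp
  ultimately show False
    using \<open>d > 0\<close> \<open>n > 0\<close> by simp
qed

text \<open>A hyperplane separating \<open>(x, F x)\<close> from the strict epigraph cannot be
  vertical, since the epigraph lies over the whole space. Dividing by its vertical coefficient gives
  the slope.\<close>

lemma convex_on_subgradient:
  fixes F :: "'a::euclidean_space \<Rightarrow> real"
  assumes "convex_on UNIV F"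
  shows "\<exists>g. \<forall>y. F y \<ge> F x + g \<bullet> (y - x)"
proof -
  let ?T = "{(y, t). F y < t}"
  have "convex ?T"
  proof (rule convexI, clarsimp)
    fix y t z s and u v :: real
    assume *: "F y < t" "F z < s" "0 \<le> u" "0 \<le> v" "u + v = 1"
    have "F (u *\<^sub>R y + v *\<^sub>R z) \<le> u * F y + v * F z"
      using * assms by (simp add: convex_on_def)
    also have "\<dots> < u * t + v * s"
    proof (cases "u = 0")
      case False
      then show ?thesis using * by (intro add_less_le_mono mult_strict_left_mono mult_left_mono) auto
    qed (use * in auto)
    finally show "F (u *\<^sub>R y + v *\<^sub>R z) < u * t + v * s" .
  qed
  moreover have "(x, F x + 1) \<in> ?T" by simp
  ultimately obtain ab b where ab: "ab \<noteq> 0" "\<forall>p\<in>{(x, F x)}. ab \<bullet> p \<le> b" "\<forall>p\<in>?T. ab \<bullet> p \<ge> b"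
    using separating_hyperplane_sets[of "{(x, F x)}" ?T] by fastforce
  obtain a c where [simp]: "ab = (a, c)" by fastforce
  have le: "a \<bullet> x + c * F x \<le> a \<bullet> y + c * t" if "F y < t" for y t
    using ab(2) ab(3)[rule_format, of "(y, t)"] that by simp
  have "c \<ge> 0"
    using le[of x "F x + 1"] by (simp add: algebra_simps)
  have "c \<noteq> 0"
  proof
    assume "c = 0"
    then have "a \<bullet> a \<le> 0"
      using le[of "x - a" "F (x - a) + 1"] by (simp add: inner_diff_right)
    then have "a = 0"
      by (metis inner_gt_zero_iff not_less)
    then show False
      using \<open>c = 0\<close> ab(1) by (simp add: zero_prod_def)
  qed
  with \<open>c \<ge> 0\<close> have "c > 0" by simp
  have "F x + (- a /\<^sub>R c) \<bullet> (y - x) \<le> F y" for y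
  proof (rule field_le_epsilon)
    fix e :: real assume "e > 0"
    have "(a \<bullet> x + c * F x) / c \<le> (a \<bullet> y + c * (F y + e)) / c"
      using le[of y "F y + e"] \<open>e > 0\<close> \<open>c > 0\<close> by (intro divide_right_mono) auto
    then have "(a \<bullet> x) / c + F x \<le> (a \<bullet> y) / c + (F y + e)"
      using \<open>c > 0\<close> by (simp add: add_divide_distrib)
    then show "F x + (- a /\<^sub>R c) \<bullet> (y - x) \<le> F y + e"
      by (simp add: inner_diff_right divide_inverse algebra_simps)
  qed
  then show ?thesis by blast
qed

text \<open>A subgradient \<open>g\<close> bounds \<open>F (x - u)\<close> from below, so the
  second-difference bound turns into an upper bound for \<open>F (x + u)\<close> by the expansion
  with slope \<open>g\<close>. The subgradient inequality at \<open>x + u\<close> is the other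
  half.\<close>

lemma convex_on_GDERIV_second_difference:
  fixes F :: "'a::euclidean_space \<Rightarrow> real"
  assumes "convex_on UNIV F"
    and "\<And>\<epsilon>. \<epsilon> > 0 \<Longrightarrow> \<exists>\<delta>>0. \<forall>u. norm u \<le> \<delta> \<longrightarrow> F (x + u) + F (x - u) - 2 * F x \<le> \<epsilon> * norm u"
  shows "\<exists>g. GDERIV F x :> g"
proof -
  obtain g where g: "\<And>y. F y \<ge> F x + g \<bullet> (y - x)"
    using convex_on_subgradient[OF assms(1)] by blast
  have "GDERIV F x :> g"
  proof (rule GDERIV_I_eps)
    fix \<epsilon> :: real assume "\<epsilon> > 0"
    then obtain d where "d > 0"
      and d: "\<And>u. norm u \<le> d \<Longrightarrow> F (x + u) + F (x - u) - 2 * F x \<le> \<epsilon> * norm u"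
      using assms(2) by blast
    have "\<bar>F (x + u) - F x - g \<bullet> u\<bar> \<le> \<epsilon> * norm u" if "norm u \<le> d" for u
      using d[OF that] g[of "x + u"] g[of "x - u"] by simp
    then show "\<exists>\<delta>>0. \<forall>u. norm u \<le> \<delta> \<longrightarrow> \<bar>F (x + u) - F x - g \<bullet> u\<bar> \<le> \<epsilon> * norm u"
      using \<open>d > 0\<close> by blast
  qed
  then show ?thesis ..
qed

text \<open>If the slope changed much between \<open>x\<close> and a nearby \<open>y\<close>, the
  tangent plane at \<open>y\<close> would rise above the first-order expansion at \<open>x\<close>
  in the direction \<open>D y - D x\<close>.\<close>

lemma convex_on_GDERIV_continuous:
  fixes F :: "'a::euclidean_space \<Rightarrow> real"
  assumes "convex_on UNIV F" "\<And>x. GDERIV F x :> D x"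
  shows "continuous_on UNIV D"
  unfolding continuous_on_iff
proof (intro ballI allI impI)
  fix x :: 'a and e :: real assume "e > 0"
  obtain d where "d > 0" and d: "\<And>u. norm u \<le> d \<Longrightarrow> \<bar>F (x + u) - F x - D x \<bullet> u\<bar> \<le> e / 3 * norm u"
    using GDERIV_eps[OF assms(2), of "e / 3" x] \<open>e > 0\<close> by auto
  have "norm (D y - D x) < e" if "norm (y - x) < d / 2" for y
  proof (cases "D y = D x")
    case False
    define n where "n = norm (D y - D x)"
    have "n > 0" using False by (simp add: n_def)
    define w where "w = (d / 2 / n) *\<^sub>R (D y - D x)"
    have nw: "norm w = d / 2"
      using \<open>d > 0\<close> \<open>n > 0\<close> by (simp add: w_def n_def)
    have nu: "norm (y - x + w) \<le> d"
      using norm_triangle_ineq[of "y - x" w] nw that by simp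
    have "F (y + w) \<ge> F y + D y \<bullet> w" "F y \<ge> F x + D x \<bullet> (y - x)"
      using convex_on_GDERIV_ge[OF assms(1) assms(2)[of y], of "y + w"]
        convex_on_GDERIV_ge[OF assms(1) assms(2)[of x], of y] by simp_all
    moreover have "F (y + w) \<le> F x + D x \<bullet> (y - x + w) + e / 3 * norm (y - x + w)"
      using d[OF nu] unfolding abs_le_iff by (simp add: algebra_simps)
    moreover have "e / 3 * norm (y - x + w) \<le> e / 3 * d"
      using nu \<open>e > 0\<close> by (intro mult_left_mono) auto
    ultimately have "(D y - D x) \<bullet> w \<le> e / 3 * d"
      by (simp add: inner_diff_left inner_add_right)
    moreover have "(D y - D x) \<bullet> w = d / 2 * n"
      using \<open>n > 0\<close> by (simp add: w_def n_def dot_square_norm power2_eq_square)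
    ultimately have "d * (n / 2) \<le> d * (e / 3)" by (simp add: mult.commute)
    then have "n / 2 \<le> e / 3" using \<open>d > 0\<close> by simp
    then show ?thesis using \<open>e > 0\<close> by (simp add: n_def)
  qed (use \<open>e > 0\<close> in simp)
  then show "\<exists>d>0. \<forall>x'\<in>UNIV. dist x' x < d \<longrightarrow> dist (D x') (D x) < e"
    using \<open>d > 0\<close> by (intro exI[of _ "d / 2"]) (auto simp: dist_norm)
qed

text \<open>\<open>D\<close> is uniformly continuous on a slightly larger ball, and the mean value
  inequality turns its modulus of continuity into one for the expansion.\<close>

lemma GDERIV_uniform_on_cball:
  fixes F :: "'a::euclidean_space \<Rightarrow> real"
  assumes "\<And>x. GDERIV F x :> D x" "continuous_on UNIV D" "\<epsilon> > 0"
  shows "\<exists>\<delta>>0. \<forall>x u. norm x \<le> R \<longrightarrow> norm u \<le> \<delta> \<longrightarrow> \<bar>F (x + u) - F x - D x \<bullet> u\<bar> \<le> \<epsilon> * norm u"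
proof -
  have "uniformly_continuous_on (cball 0 (R + 1)) D"
    using assms(2) by (intro compact_uniformly_continuous) (auto intro: continuous_on_subset)
  then obtain d where "d > 0"
    and d: "\<And>x y. x \<in> cball 0 (R + 1) \<Longrightarrow> y \<in> cball 0 (R + 1) \<Longrightarrow> dist y x < d \<Longrightarrow> dist (D y) (D x) < \<epsilon>"
    unfolding uniformly_continuous_on_def using \<open>\<epsilon> > 0\<close> by metis
  define \<delta> where "\<delta> = min 1 (d / 2)"
  have "\<delta> > 0" using \<open>d > 0\<close> by (simp add: \<delta>_def)
  have "\<bar>F (x + u) - F x - D x \<bullet> u\<bar> \<le> \<epsilon> * norm u" if x: "norm x \<le> R" and u: "norm u \<le> \<delta>" for x u
  proof -
    have "norm (F (x + u) - F x - u \<bullet> D x) \<le> norm u * \<epsilon>"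
    proof (rule differentiable_bound_linearization[of x "x + u" "cball x \<delta>" F "\<lambda>y h. h \<bullet> D y" x \<epsilon>,
          unfolded add_diff_cancel_left'])
      show "x + t *\<^sub>R u \<in> cball x \<delta>" if "t \<in> {0..1}" for t
        using u that mult_mono[of t 1 "norm u" \<delta>] by (auto simp: dist_norm)
      show "(F has_derivative (\<lambda>h. h \<bullet> D y)) (at y within cball x \<delta>)" for y
        using assms(1)[of y] by (simp add: gderiv_def has_derivative_at_withinI)
      show "x \<in> cball x \<delta>" using \<open>\<delta> > 0\<close> by simp
      show "onorm ((\<lambda>h. h \<bullet> D y) - (\<lambda>h. h \<bullet> D x)) \<le> \<epsilon>" if y: "y \<in> cball x \<delta>" for y
        unfolding fun_diff_def
      proof (rule onorm_le)
        fix h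
        have "norm y \<le> R + 1"
          using y x norm_triangle_ineq[of x "y - x"] by (simp add: \<delta>_def dist_norm norm_minus_commute)
        then have "dist (D y) (D x) < \<epsilon>"
          using d[of x y] y x \<open>d > 0\<close> by (simp add: \<delta>_def dist_commute)
        then have "norm (D y - D x) \<le> \<epsilon>" by (simp add: dist_norm)
        have "norm (h \<bullet> (D y - D x)) \<le> norm h * norm (D y - D x)"
          by (simp add: Cauchy_Schwarz_ineq2)
        also have "\<dots> \<le> norm h * \<epsilon>"
          using \<open>norm (D y - D x) \<le> \<epsilon>\<close> by (intro mult_left_mono) auto
        finally show "norm (h \<bullet> D y - h \<bullet> D x) \<le> \<epsilon> * norm h"
          by (simp add: inner_diff_right mult.commute)
      qed
    qed
    then show ?thesis by (simp add: inner_commute mult.commute)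
  qed
  then show ?thesis using \<open>\<delta> > 0\<close> by blast
qed

section \<open>Differentiability of convex envelopes\<close>

text \<open>A bound on second differences, unlike one on first-order expansions, needs no choice of a slope,
  so it passes directly to infima of families with a common modulus and to convex envelopes.\<close>
definition upper_smooth :: "('a::real_normed_vector \<Rightarrow> real) \<Rightarrow> bool" where
  "upper_smooth h \<longleftrightarrow>
     (\<forall>R. \<forall>\<epsilon>>0. \<exists>\<delta>>0. \<forall>x v. norm x \<le> R \<longrightarrow> norm v \<le> \<delta> \<longrightarrow>
        h (x + v) + h (x - v) - 2 * h x \<le> \<epsilon> * norm v)"

text \<open>\<open>F\<close> is the lower boundary of the convex hull of the graph of
  \<open>h\<close>. A nearly optimal convex combination for \<open>x\<close> is perturbed into
  combinations for \<open>x + v\<close> and \<open>x - v\<close>, so second differences of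
  \<open>h\<close> control those of \<open>F\<close>. The minorant \<open>m\<close> keeps
  \<open>F\<close> finite, and its coercivity confines enough weight to a ball on which the modulus
  of \<open>h\<close> is uniform.\<close>

lemma convex_envelope_GDERIV:
  fixes h m :: "'a::euclidean_space \<Rightarrow> real"
  assumes smooth: "upper_smooth h"
    and conv: "convex_on UNIV m" and le: "\<And>x. m x \<le> h x"
    and coer: "\<And>x. m x \<ge> a \<bullet> x + \<kappa> * norm x - C" and "\<kappa> > 0"
  shows "\<exists>F. convex_on UNIV F \<and> (\<forall>x. \<exists>g. GDERIV F x :> g) \<and> (\<forall>x. m x \<le> F x \<and> F x \<le> h x)"
proof -
  define H where "H = convex hull range (\<lambda>y. (y, h y))"
  define T where "T x = {t. (x, t) \<in> H}" for x
  define F where "F x = Inf (T x)" for x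
  have m_le: "m x \<le> t" if "t \<in> T x" for x t
  proof -
    have "H \<subseteq> epigraph UNIV m"
      unfolding H_def using conv le
      by (intro hull_minimal) (auto simp: convex_epigraph, auto simp: epigraph_def)
    then show ?thesis
      using that by (auto simp: T_def epigraph_def)
  qed
  have bdd: "bdd_below (T x)" for x
    by (rule bdd_belowI[of _ "m x"]) (rule m_le)
  have h_in: "h x \<in> T x" for x
    unfolding T_def H_def mem_Collect_eq by (rule hull_inc) (rule rangeI)
  have F_le: "F x \<le> t" if "t \<in> T x" for x t
    unfolding F_def using that bdd by (rule cInf_lower)
  have F_approx: "\<exists>t\<in>T x. t < F x + e" if "e > 0" for x e
  proof -
    have "T x \<noteq> {}" using h_in[of x] by auto
    moreover have "Inf (T x) < F x + e" using that by (simp add: F_def)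
    ultimately show ?thesis
      using cInf_lessD by blast
  qed
  have F_m: "m x \<le> F x" for x
    unfolding F_def using h_in m_le by (intro cInf_greatest) auto
  have F_h: "F x \<le> h x" for x
    using F_le h_in .
  have "convex H"
    by (simp add: H_def)
  have F_conv: "convex_on UNIV F"
    unfolding convex_on_def
  proof (intro conjI ballI allI impI)
    fix x y and u v :: real
    assume uv: "0 \<le> u" "0 \<le> v" "u + v = 1"
    show "F (u *\<^sub>R x + v *\<^sub>R y) \<le> u * F x + v * F y"
    proof (rule field_le_epsilon)
      fix e :: real assume "e > 0"
      obtain t s where t: "t \<in> T x" "t < F x + e" and s: "s \<in> T y" "s < F y + e"
        using F_approx \<open>e > 0\<close> by metis
      have "u *\<^sub>R (x, t) + v *\<^sub>R (y, s) \<in> H"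
        using t s uv by (intro convexD[OF \<open>convex H\<close>]) (auto simp: T_def)
      then have "F (u *\<^sub>R x + v *\<^sub>R y) \<le> u * t + v * s"
        by (intro F_le) (simp add: T_def)
      also have "\<dots> \<le> u * (F x + e) + v * (F y + e)"
        using uv t s by (intro add_mono mult_left_mono) auto
      also have "\<dots> = u * F x + v * F y + (u + v) * e"
        by (simp add: algebra_simps)
      finally show "F (u *\<^sub>R x + v *\<^sub>R y) \<le> u * F x + v * F y + e"
        using uv by simp
    qed
  qed simp
  have "\<exists>g. GDERIV F x :> g" for x
  proof (rule convex_on_GDERIV_second_difference[OF F_conv])
    fix \<epsilon> :: real assume "\<epsilon> > 0"
    \<comment> \<open>For every convex combination representing a point \<open>(x, t)\<close> with
      \<open>t < F x + 1\<close>, coercivity bounds the mean norm of its points by \<open>L\<close>.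
      The factor 2 in \<open>R\<close> is for Markov's inequality; the added 1 keeps
      \<open>R\<close> positive.\<close>
    define K where "K = F x + 1 - a \<bullet> x + C"
    define L where "L = K / \<kappa>"
    define R where "R = 2 * L + 1"
    obtain d where "d > 0" and d: "\<And>y v. norm y \<le> R \<Longrightarrow> norm v \<le> d \<Longrightarrow>
        h (y + v) + h (y - v) - 2 * h y \<le> \<epsilon> * norm v"
      using smooth \<open>\<epsilon> > 0\<close> unfolding upper_smooth_def by blast
    have "F (x + v) + F (x - v) - 2 * F x \<le> \<epsilon> * norm v" if v: "norm v \<le> d / 2" for v
    proof (rule field_le_epsilon)
      fix e :: real assume "e > 0"
      \<comment> \<open>The cap 1 keeps \<open>K\<close>, \<open>L\<close> and \<open>R\<close>
        independent of \<open>e\<close>; the cap \<open>e / 2\<close> pays for replacing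
        \<open>2 * F x\<close> by \<open>2 * t\<close>.\<close>
      obtain t where t: "t \<in> T x" "t < F x + min 1 (e / 2)"
        using F_approx[of "min 1 (e / 2)" x] \<open>e > 0\<close> by auto
      obtain k and u :: "nat \<Rightarrow> real" and p
        where u0: "\<And>i. i \<in> {1..k} \<Longrightarrow> 0 \<le> u i"
          and p: "\<And>i. i \<in> {1..k} \<Longrightarrow> p i \<in> range (\<lambda>y. (y, h y))"
          and u1: "sum u {1..k} = 1" and sum_p: "(\<Sum>i=1..k. u i *\<^sub>R p i) = (x, t)"
        using t(1) unfolding T_def H_def convex_hull_indexed by blast
      define y where "y i = fst (p i)" for i
      have p_eq: "p i = (y i, h (y i))" if "i \<in> {1..k}" for i
        using p[OF that] by (auto simp: y_def)
      have sum_p': "(\<Sum>i=1..k. u i *\<^sub>R (y i, h (y i))) = (x, t)"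
        using sum_p p_eq by (metis (no_types, lifting) sum.cong)
      have sum_y: "(\<Sum>i=1..k. u i *\<^sub>R y i) = x"
        using arg_cong[OF sum_p', of fst] by (simp add: fst_sum)
      have sum_h: "(\<Sum>i=1..k. u i * h (y i)) = t"
        using arg_cong[OF sum_p', of snd] by (simp add: snd_sum)
      have k0: "{1..k} \<noteq> {}"
        using u1 by fastforce
      have "\<kappa> * (\<Sum>i=1..k. u i * norm (y i)) \<le> K"
      proof -
        have "(\<Sum>i=1..k. u i * (a \<bullet> y i + \<kappa> * norm (y i) - C)) \<le> (\<Sum>i=1..k. u i * h (y i))"
          using u0 coer le order_trans by (intro sum_mono mult_left_mono) blast+
        moreover have "(\<Sum>i=1..k. u i * (a \<bullet> y i + \<kappa> * norm (y i) - C)) =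
            a \<bullet> (\<Sum>i=1..k. u i *\<^sub>R y i) + \<kappa> * (\<Sum>i=1..k. u i * norm (y i)) - sum u {1..k} * C"
          by (simp add: inner_sum_right sum_distrib_left sum_distrib_right algebra_simps
              sum.distrib sum_subtractf)
        ultimately show ?thesis
          using t(2) by (simp add: sum_y sum_h u1 K_def del: One_nat_def)
      qed
      then have mass: "(\<Sum>i=1..k. u i * norm (y i)) \<le> L"
        using \<open>\<kappa> > 0\<close> by (simp add: L_def field_simps)
      have "0 \<le> (\<Sum>i=1..k. u i * norm (y i))"
        using u0 by (intro sum_nonneg) auto
      then have "R > 0"
        using mass unfolding R_def by linarith
      have KR: "L \<le> R / 2"
        by (simp add: R_def add_divide_distrib)
      \<comment> \<open>By coercivity the points outside the ball of radius \<open>R\<close> carry at most half of the weight, so the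
        barycentre can be moved by \<open>v\<close> by shifting only the points inside it, by at most \<open>2 |v|\<close>.\<close>
      define I where "I = {i\<in>{1..k}. norm (y i) \<le> R}"
      define \<Lambda> where "\<Lambda> = sum u I"
      have "\<Lambda> \<ge> 1 / 2"
      proof -
        have "(\<Sum>i\<in>{1..k} - I. u i) * R \<le> (\<Sum>i\<in>{1..k} - I. u i * norm (y i))"
          unfolding sum_distrib_right using u0
          by (intro sum_mono mult_left_mono) (auto simp: I_def)
        also have "\<dots> \<le> (\<Sum>i=1..k. u i * norm (y i))"
          using u0 by (intro sum_mono2) auto
        finally have "(\<Sum>i\<in>{1..k} - I. u i) * R \<le> 1 / 2 * R"
          using mass KR by simp
        then have "(\<Sum>i\<in>{1..k} - I. u i) \<le> 1 / 2"
          using \<open>R > 0\<close> by (meson mult_right_le_imp_le)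
        moreover have "(\<Sum>i\<in>{1..k} - I. u i) = 1 - \<Lambda>"
          unfolding \<Lambda>_def using u1 by (subst sum_diff) (auto simp: I_def)
        ultimately show ?thesis by simp
      qed
      define w where "w = v /\<^sub>R \<Lambda>"
      have \<Lambda>w: "\<Lambda> *\<^sub>R w = v" "\<Lambda> * norm w = norm v"
        using \<open>\<Lambda> \<ge> 1 / 2\<close> by (simp_all add: w_def)
      have "1 / 2 * norm w \<le> \<Lambda> * norm w"
        using \<open>\<Lambda> \<ge> 1 / 2\<close> by (intro mult_right_mono) auto
      then have "norm w \<le> d"
        using v \<Lambda>w by simp
      define z where "z i = (if i \<in> I then w else 0)" for i
      have sum_z: "(\<Sum>i=1..k. u i *\<^sub>R z i) = v"
      proof -
        have "(\<Sum>i=1..k. u i *\<^sub>R z i) = (\<Sum>i\<in>I. u i *\<^sub>R w)"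
          by (rule sum.mono_neutral_cong_right) (auto simp: z_def I_def)
        also have "\<dots> = v"
          by (simp add: scaleR_sum_left[symmetric] \<Lambda>_def[symmetric] \<Lambda>w)
        finally show ?thesis .
      qed
      have F_sum: "F (\<Sum>i=1..k. u i *\<^sub>R q i) \<le> (\<Sum>i=1..k. u i * h (q i))" for q
      proof -
        have "F (\<Sum>i=1..k. u i *\<^sub>R q i) \<le> (\<Sum>i=1..k. u i * F (q i))"
          using k0 F_conv u1 u0 by (intro convex_on_sum) auto
        also have "\<dots> \<le> (\<Sum>i=1..k. u i * h (q i))"
          using u0 F_h by (intro sum_mono mult_left_mono) auto
        finally show ?thesis .
      qed
      have "F (x + v) \<le> (\<Sum>i=1..k. u i * h (y i + z i))" "F (x - v) \<le> (\<Sum>i=1..k. u i * h (y i - z i))"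
        using F_sum[of "\<lambda>i. y i + z i"] F_sum[of "\<lambda>i. y i - z i"]
        by (simp_all add: scaleR_add_right scaleR_diff_right sum.distrib sum_subtractf sum_y sum_z del: One_nat_def)
      then have "F (x + v) + F (x - v) - 2 * t \<le>
          (\<Sum>i=1..k. u i * (h (y i + z i) + h (y i - z i) - 2 * h (y i)))"
        unfolding sum_h[symmetric]
        by (simp add: algebra_simps sum.distrib sum_subtractf sum_distrib_left)
      also have "\<dots> \<le> (\<Sum>i=1..k. u i * (\<epsilon> * norm (z i)))"
      proof (intro sum_mono mult_left_mono u0)
        fix i
        show "h (y i + z i) + h (y i - z i) - 2 * h (y i) \<le> \<epsilon> * norm (z i)"
          using d[of "y i" w] \<open>norm w \<le> d\<close> by (auto simp: z_def I_def)
      qed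
      also have "\<dots> = (\<Sum>i\<in>I. u i * (\<epsilon> * norm w))"
        by (rule sum.mono_neutral_cong_right) (auto simp: z_def I_def)
      also have "\<dots> = \<Lambda> * norm w * \<epsilon>"
        by (simp add: \<Lambda>_def sum_distrib_left sum_distrib_right mult_ac)
      finally show "F (x + v) + F (x - v) - 2 * F x \<le> \<epsilon> * norm v + e"
        using t(2) by (simp add: \<Lambda>w mult.commute)
    qed
    then show "\<exists>\<delta>>0. \<forall>u. norm u \<le> \<delta> \<longrightarrow> F (x + u) + F (x - u) - 2 * F x \<le> \<epsilon> * norm u"
      using \<open>d > 0\<close> by (intro exI[of _ "d / 2"]) auto
  qed
  then show ?thesis
    using F_conv F_m F_h by blast
qed

section \<open>Smooth radial majorants of continuous functions\<close>

text \<open>The integral up to \<open>t + 1\<close> of a nonnegative nondecreasing function contains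
  the window of length 1 that starts at \<open>t\<close>, so it is at least \<open>A t\<close>. One
  integration gives a continuous function, the second one a C1 function.\<close>

lemma mono_le_C1:
  fixes A :: "real \<Rightarrow> real"
  assumes "mono A" and "\<And>t. A t \<ge> 0"
  shows "\<exists>B B'. (\<forall>t\<ge>0. DERIV B t :> B' t) \<and> continuous_on {0..} B' \<and> (\<forall>t\<ge>0. A t \<le> B t)"
proof -
  \<comment> \<open>The lower limits -2 and -1 keep the window inside the range of integration for
    \<open>t \<ge> -1\<close> and \<open>t \<ge> 0\<close>, and leave room to differentiate
    \<open>B\<close> from both sides at 0.\<close>
  define B1 where "B1 t = integral {-2..t + 1} A" for t
  define B where "B t = integral {-1..t + 1} B1" for t
  have intA: "A integrable_on {a..b}" for a b
    using assms(1) by (intro integrable_on_mono_on) (auto simp: mono_on_def mono_def)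
  have contB1: "continuous_on {-3..b} B1" for b
  proof -
    have "continuous_on {-2..b + 1} (\<lambda>x. integral {-2..x} A)"
      by (intro indefinite_integral_continuous_1 intA)
    then have "continuous_on {-3..b} ((\<lambda>x. integral {-2..x} A) \<circ> (\<lambda>t. t + 1))"
      by (intro continuous_on_compose) (auto intro!: continuous_intros)
    then show ?thesis
      by (simp add: B1_def o_def)
  qed
  have B1_ge: "A t \<le> B1 t" if "t \<ge> -1" for t
  proof -
    have "A t = integral {t..t + 1} (\<lambda>_. A t)" by simp
    also have "\<dots> \<le> integral {t..t + 1} A"
      using assms(1) by (intro integral_le intA) (auto simp: mono_def)
    also have "\<dots> \<le> B1 t"
      unfolding B1_def using that assms(2) by (intro integral_subset_le intA) auto
    finally show ?thesis .
  qed
  have B1_nonneg: "0 \<le> B1 t" if "t \<ge> -1" for t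
    using B1_ge[OF that] assms(2)[of t] by simp
  have intB1: "B1 integrable_on {a..b}" if "a \<ge> -1" for a b
    using contB1[of b] that by (intro integrable_continuous_interval) (auto intro: continuous_on_subset)
  have B_ge: "A t \<le> B t" if "t \<ge> 0" for t
  proof -
    have "A t = integral {t..t + 1} (\<lambda>_. A t)" by simp
    also have "\<dots> \<le> integral {t..t + 1} B1"
    proof (intro integral_le intB1)
      fix s assume "s \<in> {t..t + 1}"
      then show "A t \<le> B1 s"
        using B1_ge[of s] monoD[OF assms(1), of t s] that by simp
    qed (use that in auto)
    also have "\<dots> \<le> B t"
      unfolding B_def using that B1_nonneg by (intro integral_subset_le intB1) auto
    finally show ?thesis .
  qed
  have 1: "DERIV B t :> B1 (t + 1)" if "t \<ge> 0" for t
  proof -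
    have "((\<lambda>x. integral {-1..x} B1) has_real_derivative B1 (t + 1)) (at (t + 1) within {-1..t + 2})"
      using contB1[of "t + 2"] that
      by (intro integral_has_real_derivative) (auto intro: continuous_on_subset)
    then have "((\<lambda>x. integral {-1..x} B1) has_real_derivative B1 (t + 1)) (at (t + 1))"
      using that by (simp add: at_within_Icc_at)
    then show ?thesis
      unfolding B_def by (rule DERIV_shift[THEN iffD1])
  qed
  have 2: "continuous_on {0..} (\<lambda>t. B1 (t + 1))"
    unfolding continuous_on_eq_continuous_within
  proof
    fix t :: real assume "t \<in> {0..}"
    then have "isCont B1 (t + 1)"
      using contB1[of "t + 2"] by (intro continuous_on_interior[of "{-3..t + 2}"]) auto
    then have "isCont (\<lambda>t. B1 (t + 1)) t"
      by (intro isCont_o2[where g = B1 and f = "\<lambda>t. t + 1"]) (auto intro!: continuous_intros)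
    then show "continuous (at t within {0..}) (\<lambda>t. B1 (t + 1))"
      by (rule continuous_at_imp_continuous_at_within)
  qed
  show ?thesis
    using 1 2 B_ge by (intro exI[of _ B] exI[of _ "\<lambda>t. B1 (t + 1)"]) simp
qed

text \<open>The supremum of \<open>m\<close> over balls is dominated by a C1 function of the squared
  radius; \<open>x \<bullet> x\<close> in place of the norm keeps the composite differentiable at
  the origin.\<close>

lemma continuous_le_C1:
  fixes m :: "'a::euclidean_space \<Rightarrow> real"
  assumes "continuous_on UNIV m"
  shows "\<exists>Q DQ. (\<forall>x. GDERIV Q x :> DQ x) \<and> continuous_on UNIV DQ \<and> (\<forall>x. m x \<le> Q x)"
proof -
  \<comment> \<open>Inserting 0 makes \<open>A\<close> nonnegative and gives it a value for negative
    \<open>t\<close>, where the ball is empty.\<close>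
  define S where "S t = insert 0 (m ` {x. x \<bullet> x \<le> t})" for t
  define A where "A t = Sup (S t)" for t
  have bdd: "bdd_above (S t)" for t
  proof -
    have "m ` {x. x \<bullet> x \<le> t} \<subseteq> m ` cball 0 (sqrt t)"
      by (auto simp: norm_eq_sqrt_inner)
    moreover have "compact (m ` cball 0 (sqrt t))"
      using assms by (intro compact_continuous_image) (auto intro: continuous_on_subset)
    ultimately have "bdd_above (m ` {x. x \<bullet> x \<le> t})"
      by (meson bounded_imp_bdd_above bounded_subset compact_imp_bounded)
    then show ?thesis
      by (simp add: S_def)
  qed
  have "mono A"
    unfolding A_def mono_def using bdd by (intro allI impI cSup_subset_mono) (auto simp: S_def)
  have "A t \<ge> 0" for t
    unfolding A_def using bdd by (intro cSup_upper) (auto simp: S_def)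
  from mono_le_C1[OF \<open>mono A\<close> this]
  obtain B B' where B: "\<And>t. t \<ge> 0 \<Longrightarrow> DERIV B t :> B' t" "continuous_on {0..} B'"
      "\<And>t. t \<ge> 0 \<Longrightarrow> A t \<le> B t"
    by blast
  have "m x \<le> A (x \<bullet> x)" for x
    unfolding A_def using bdd by (intro cSup_upper) (auto simp: S_def)
  then have 1: "m x \<le> B (x \<bullet> x)" for x
    using B(3)[OF inner_ge_zero[of x]] order_trans by blast
  have 2: "GDERIV (\<lambda>x. B (x \<bullet> x)) x :> B' (x \<bullet> x) *\<^sub>R (2 *\<^sub>R x)" for x :: 'a
  proof (rule GDERIV_DERIV_compose[where f = "\<lambda>x. x \<bullet> x" and g = B])
    show "GDERIV (\<lambda>x. x \<bullet> x) x :> 2 *\<^sub>R x"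
      unfolding gderiv_def by (auto intro!: derivative_eq_intros simp: inner_commute)
  qed (use B in auto)
  have "continuous_on UNIV (\<lambda>x::'a. B' (x \<bullet> x))"
    by (rule continuous_on_compose2[OF B(2)]) (auto intro!: continuous_intros)
  then have 3: "continuous_on UNIV (\<lambda>x::'a. B' (x \<bullet> x) *\<^sub>R (2 *\<^sub>R x))"
    by (intro continuous_intros)
  show ?thesis
    by (intro exI[of _ "\<lambda>x. B (x \<bullet> x)"] exI[of _ "\<lambda>x. B' (x \<bullet> x) *\<^sub>R (2 *\<^sub>R x)"] conjI allI 1 2 3)
qed

section \<open>Upper smooth majorants\<close>

text \<open>If a nearly optimal paraboloid at \<open>x\<close> has moderate curvature, its own
  second difference bounds that of the infimum. If its curvature is large, it must be based close to
  \<open>x\<close>, and there the first-order upper bound for \<open>h\<close> around the base point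
  takes over.\<close>

lemma upper_smooth_majorant:
  fixes k :: "'a::real_inner \<Rightarrow> real" and g :: "'a \<Rightarrow> 'a"
  assumes "E \<noteq> {}" and k_le: "\<And>x. k x \<le> 0"
    and bdd: "\<And>R. \<exists>C\<ge>0. \<forall>e\<in>E. norm e \<le> R \<longrightarrow> \<bar>k e\<bar> \<le> C \<and> norm (g e) \<le> C"
    and unif: "\<And>R \<epsilon>. \<epsilon> > 0 \<Longrightarrow> \<exists>\<delta>>0. \<forall>e\<in>E. norm e \<le> R \<longrightarrow>
        (\<forall>u. norm u \<le> \<delta> \<longrightarrow> k (e + u) \<le> k e + g e \<bullet> u + \<epsilon> * norm u)"
  shows "\<exists>h. upper_smooth h \<and> (\<forall>x. k x \<le> h x) \<and> (\<forall>e\<in>E. h e = k e)"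
proof -
  define q where "q e s c y = s + k e + g e \<bullet> (y - e) + c * (norm (y - e))\<^sup>2" for e s c y
  \<comment> \<open>The lower bound on \<open>c\<close> makes the paraboloids based at distant \<open>e\<close> irrelevant on bounded sets.\<close>
  define adm where "adm e s c \<longleftrightarrow> e \<in> E \<and> s > 0 \<and> c \<ge> \<bar>k e\<bar> + norm (g e) + norm e \<and> (\<forall>y. k y \<le> q e s c y)"
    for e s c
  define h where "h x = Inf {q e s c x | e s c. adm e s c}" for x
  \<comment> \<open>With offset \<open>\<epsilon> * t / 2\<close> and coefficient
    \<open>\<epsilon> / (2 * t)\<close> the parabola in \<open>r\<close> touches the line
    \<open>\<epsilon> * r\<close> from above at \<open>r = t\<close>, so the paraboloid dominates
    the upper bound that \<open>unif\<close> gives near \<open>e\<close>.\<close>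
  have adm_small: "\<exists>\<delta>>0. \<forall>e\<in>E. norm e \<le> R \<longrightarrow> (\<forall>t. 0 < t \<and> t \<le> \<delta> \<longrightarrow> adm e (\<epsilon> * t / 2) (\<epsilon> / (2 * t)))"
    if "\<epsilon> > 0" for R \<epsilon> :: real
  proof -
    obtain C where "C \<ge> 0" and C: "\<And>e. e \<in> E \<Longrightarrow> norm e \<le> R \<Longrightarrow> \<bar>k e\<bar> \<le> C \<and> norm (g e) \<le> C"
      using bdd[of R] by blast
    obtain d where "d > 0" and d: "\<And>e u. e \<in> E \<Longrightarrow> norm e \<le> R \<Longrightarrow> norm u \<le> d \<Longrightarrow>
        k (e + u) \<le> k e + g e \<bullet> u + \<epsilon> * norm u"
      using unif[OF \<open>\<epsilon> > 0\<close>, of R] by blast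
    \<comment> \<open>If the coefficient of the square is at least \<open>D\<close>, the paraboloid
      is nonnegative at distances above \<open>d\<close>, which suffices as
      \<open>k \<le> 0\<close>, and it meets the lower bound on \<open>c\<close> in
      \<open>adm\<close>.\<close>
    define D where "D = 2 * C + \<bar>R\<bar> + C / d\<^sup>2 + C / d + 1"
    have "D > 0"
      using \<open>C \<ge> 0\<close> \<open>d > 0\<close> by (simp add: D_def add_nonneg_pos)
    have "adm e (\<epsilon> * t / 2) (\<epsilon> / (2 * t))"
      if e: "e \<in> E" "norm e \<le> R" and t: "0 < t" "t \<le> \<epsilon> / (2 * D)" for e t
    proof -
      have tD: "\<epsilon> / (2 * t) \<ge> D"
        using t \<open>D > 0\<close> \<open>\<epsilon> > 0\<close> by (simp add: field_simps)
      have CD: "C / d\<^sup>2 + C / d \<le> D" "2 * C + \<bar>R\<bar> \<le> D"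
        using \<open>C \<ge> 0\<close> \<open>d > 0\<close> by (auto simp: D_def)
      have "k y \<le> q e (\<epsilon> * t / 2) (\<epsilon> / (2 * t)) y" for y
      proof -
        define r where "r = norm (y - e)"
        have "r \<ge> 0" by (simp add: r_def)
        show ?thesis
        proof (cases "r \<le> d")
          case True
          have "0 \<le> \<epsilon> * (t - r)\<^sup>2 / (2 * t)"
            using \<open>\<epsilon> > 0\<close> t by simp
          also have "\<dots> = \<epsilon> * t / 2 + \<epsilon> / (2 * t) * r\<^sup>2 - \<epsilon> * r"
            using t by (simp add: field_simps power2_eq_square)
          finally show ?thesis
            using d[of e "y - e"] e True by (simp add: q_def r_def)
        next
          case False
          have "C \<le> C / d\<^sup>2 * r\<^sup>2"
            using False \<open>d > 0\<close> \<open>C \<ge> 0\<close> by (simp add: field_simps mult_left_mono power_mono)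
          moreover have "C * r \<le> C / d * r\<^sup>2"
            using False \<open>d > 0\<close> \<open>C \<ge> 0\<close> \<open>r \<ge> 0\<close>
            by (simp add: field_simps power2_eq_square mult_left_mono mult_right_mono)
          ultimately have "C + C * r \<le> (C / d\<^sup>2 + C / d) * r\<^sup>2"
            by (simp add: distrib_right)
          also have "\<dots> \<le> \<epsilon> / (2 * t) * r\<^sup>2"
            using CD tD by (intro mult_right_mono) auto
          finally have "C + C * r \<le> \<epsilon> / (2 * t) * r\<^sup>2" .
          moreover have "\<bar>g e \<bullet> (y - e)\<bar> \<le> C * r"
            using C[OF e] Cauchy_Schwarz_ineq2[of "g e" "y - e"] mult_right_mono[of "norm (g e)" C r]
            by (simp add: r_def)
          ultimately have "0 \<le> k e + g e \<bullet> (y - e) + \<epsilon> / (2 * t) * r\<^sup>2"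
            using C[OF e] by linarith
          moreover have "0 \<le> \<epsilon> * t / 2"
            using \<open>\<epsilon> > 0\<close> t by simp
          ultimately show ?thesis
            using k_le[of y] unfolding q_def r_def by linarith
        qed
      qed
      moreover have "\<bar>k e\<bar> + norm (g e) + norm e \<le> \<epsilon> / (2 * t)"
        using C[OF e] e(2) CD tD by linarith
      ultimately show ?thesis
        using e t \<open>\<epsilon> > 0\<close> by (simp add: adm_def)
    qed
    then show ?thesis
      using \<open>D > 0\<close> \<open>\<epsilon> > 0\<close> by (intro exI[of _ "\<epsilon> / (2 * D)"]) auto
  qed
  obtain e0 where "e0 \<in> E" using \<open>E \<noteq> {}\<close> by blast
  obtain s0 c0 where adm0: "adm e0 s0 c0"
    using adm_small[of 1 "norm e0"] \<open>e0 \<in> E\<close> by (metis order_refl zero_less_one)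
  have k_h: "k x \<le> h x" for x
    unfolding h_def using adm0 by (intro cInf_greatest) (auto simp: adm_def)
  have bdd_q: "bdd_below {q e s c x | e s c. adm e s c}" for x
    by (intro bdd_belowI[of _ "k x"]) (auto simp: adm_def)
  have h_le: "h x \<le> q e s c x" if "adm e s c" for e s c x
    unfolding h_def using that bdd_q by (intro cInf_lower) auto
  have h_approx: "\<exists>e s c. adm e s c \<and> q e s c x < h x + \<eta>" if "\<eta> > 0" for x \<eta>
  proof -
    have 1: "{q e s c x | e s c. adm e s c} \<noteq> {}"
      using adm0 by blast
    have 2: "Inf {q e s c x | e s c. adm e s c} < h x + \<eta>"
      using that by (simp add: h_def)
    obtain z where "z \<in> {q e s c x | e s c. adm e s c}" "z < h x + \<eta>"
      using cInf_lessD[OF 1 2] by (rule bexE)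
    then obtain e s c where "adm e s c" "z = q e s c x"
      by (elim CollectE exE conjE)
    with \<open>z < h x + \<eta>\<close> show ?thesis
      by (intro exI[of _ e] exI[of _ s] exI[of _ c]) simp
  qed
  \<comment> \<open>For \<open>u \<noteq> 0\<close> the paraboloid with \<open>t = norm u\<close>
    takes at \<open>e + u\<close> exactly the value
    \<open>k e + g e \<bullet> u + \<epsilon> * norm u\<close>; for \<open>u = 0\<close> one lets
    \<open>t\<close> tend to 0.\<close>
  have h_near: "\<exists>\<delta>>0. \<forall>e\<in>E. norm e \<le> R \<longrightarrow> (\<forall>u. norm u \<le> \<delta> \<longrightarrow> h (e + u) \<le> k e + g e \<bullet> u + \<epsilon> * norm u)"
    if "\<epsilon> > 0" for R \<epsilon> :: real
  proof -
    obtain d where "d > 0"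
      and d: "\<And>e t. e \<in> E \<Longrightarrow> norm e \<le> R \<Longrightarrow> 0 < t \<Longrightarrow> t \<le> d \<Longrightarrow> adm e (\<epsilon> * t / 2) (\<epsilon> / (2 * t))"
      using adm_small[OF \<open>\<epsilon> > 0\<close>, of R] by blast
    have "h (e + u) \<le> k e + g e \<bullet> u + \<epsilon> * norm u" if e: "e \<in> E" "norm e \<le> R" and u: "norm u \<le> d" for e u
    proof (cases "u = 0")
      case False
      then show ?thesis
        using h_le[OF d[OF e, of "norm u"], of "e + u"] u by (simp add: q_def power2_eq_square)
    next
      case True
      have "h e \<le> k e"
      proof (rule field_le_epsilon)
        fix \<eta> :: real assume "\<eta> > 0"
        define t where "t = min d (2 * \<eta> / \<epsilon>)"
        have t: "0 < t" "t \<le> d" "\<epsilon> * t / 2 \<le> \<eta>"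
          using \<open>\<eta> > 0\<close> \<open>\<epsilon> > 0\<close> \<open>d > 0\<close> by (auto simp: t_def min_def field_simps)
        show "h e \<le> k e + \<eta>"
          using h_le[OF d[OF e t(1,2)], of e] t(3) by (simp add: q_def)
      qed
      then show ?thesis using True by simp
    qed
    then show ?thesis using \<open>d > 0\<close> by blast
  qed
  have "h e = k e" if "e \<in> E" for e
  proof -
    obtain d where "d > 0" and d: "\<forall>e'\<in>E. norm e' \<le> norm e \<longrightarrow>
        (\<forall>u. norm u \<le> d \<longrightarrow> h (e' + u) \<le> k e' + g e' \<bullet> u + 1 * norm u)"
      using h_near[of 1 "norm e"] by (auto simp only: zero_less_one)
    then show ?thesis
      using d[rule_format, of e 0] that k_h[of e] by simp
  qed
  moreover have "upper_smooth h"
    unfolding upper_smooth_def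
  proof (intro allI impI)
    fix \<rho> \<epsilon>' :: real assume "\<epsilon>' > 0"
    define \<epsilon> where "\<epsilon> = \<epsilon>' / 4"
    have "\<epsilon> > 0" using \<open>\<epsilon>' > 0\<close> by (simp add: \<epsilon>_def)
    \<comment> \<open>The fixed paraboloid \<open>q e0 s0 c0\<close> bounds \<open>h\<close> by
      \<open>A - 1\<close> on the ball of radius \<open>\<rho>\<close>, so nearly optimal
      paraboloids have value at most \<open>A\<close> there.\<close>
    define A where "A = \<bar>s0\<bar> + \<bar>k e0\<bar> + norm (g e0) * (\<rho> + norm e0) + \<bar>c0\<bar> * (\<rho> + norm e0)\<^sup>2 + 1"
    have h_A: "h x + 1 \<le> A" if "norm x \<le> \<rho>" for x
    proof -
      have n: "norm (x - e0) \<le> \<rho> + norm e0"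
        using that norm_triangle_ineq4[of x e0] by linarith
      have "g e0 \<bullet> (x - e0) \<le> norm (g e0) * (\<rho> + norm e0)"
        using norm_cauchy_schwarz[of "g e0" "x - e0"] mult_left_mono[OF n, of "norm (g e0)"] by simp
      moreover have "c0 * (norm (x - e0))\<^sup>2 \<le> \<bar>c0\<bar> * (\<rho> + norm e0)\<^sup>2"
        using n by (intro mult_mono power_mono) auto
      ultimately show ?thesis
        using h_le[OF adm0, of x] unfolding A_def q_def by linarith
    qed
    \<comment> \<open>Bases of nearly optimal paraboloids have norm at most \<open>R\<close>: for a
      base \<open>e\<close> farther out, \<open>norm (x - e)\<close> is at least 1 and the lower
      bound on \<open>c\<close> makes the value exceed \<open>A\<close>.\<close>
    define R where "R = max (\<rho> + 1) A"
    obtain C where "C \<ge> 0" and C: "\<And>e. e \<in> E \<Longrightarrow> norm e \<le> R \<Longrightarrow> \<bar>k e\<bar> \<le> C \<and> norm (g e) \<le> C"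
      using bdd[of R] by blast
    obtain d where "d > 0" and d: "\<And>e u. e \<in> E \<Longrightarrow> norm e \<le> R \<Longrightarrow> norm u \<le> d \<Longrightarrow>
        h (e + u) \<le> k e + g e \<bullet> u + \<epsilon> * norm u"
      using h_near[OF \<open>\<epsilon> > 0\<close>, of R] by blast
    \<comment> \<open>Curvature above \<open>K\<close> forces a nearly optimal base to lie within
      \<open>d / 2\<close> of \<open>x\<close>, and \<open>\<delta>\<close> is chosen such that
      \<open>c * norm v > \<epsilon>\<close> implies \<open>c > K\<close>.\<close>
    define K where "K = (\<bar>A\<bar> + C) * (4 / d\<^sup>2) + C * (2 / d)"
    have "K \<ge> 0"
      using \<open>C \<ge> 0\<close> \<open>d > 0\<close> by (simp add: K_def)
    define \<delta> where "\<delta> = min (d / 2) (\<epsilon> / (K + 1))"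
    have "\<delta> > 0"
      using \<open>\<epsilon> > 0\<close> \<open>d > 0\<close> \<open>K \<ge> 0\<close> by (simp add: \<delta>_def)
    have "h (x + v) + h (x - v) - 2 * h x \<le> \<epsilon>' * norm v" if x: "norm x \<le> \<rho>" and v: "norm v \<le> \<delta>" for x v
    proof (rule field_le_epsilon)
      fix \<eta>' :: real assume "\<eta>' > 0"
      define \<eta> where "\<eta> = min 1 (\<eta>' / 2)"
      have \<eta>: "0 < \<eta>" "\<eta> \<le> 1" "2 * \<eta> \<le> \<eta>'"
        using \<open>\<eta>' > 0\<close> by (auto simp: \<eta>_def)
      obtain e s c where adm: "adm e s c" and q_h: "q e s c x < h x + \<eta>"
        using h_approx[OF \<eta>(1)] by blast
      have "e \<in> E" "s > 0" and c: "c \<ge> \<bar>k e\<bar> + norm (g e) + norm e"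
        using adm by (auto simp: adm_def)
      have "c \<ge> 0"
        using c by (smt (verit) norm_ge_zero)
      have q_A: "q e s c x \<le> A"
        using q_h h_A[OF x] \<eta> by simp
      define w where "w = x - e"
      have "norm e \<le> R"
      proof (rule ccontr)
        assume "\<not> norm e \<le> R"
        then have "norm w \<ge> 1"
          using x norm_triangle_ineq2[of e x] by (simp add: R_def w_def norm_minus_commute)
        have "norm e \<le> norm e * (norm w)\<^sup>2"
          using \<open>norm w \<ge> 1\<close> by (simp add: mult_le_cancel_left1)
        also have "\<dots> \<le> (c - \<bar>k e\<bar> - norm (g e)) * (norm w)\<^sup>2"
          using c by (intro mult_right_mono) auto
        also have "\<dots> = c * (norm w)\<^sup>2 - \<bar>k e\<bar> * (norm w)\<^sup>2 - norm (g e) * (norm w)\<^sup>2"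
          by (simp add: algebra_simps)
        also have "\<dots> \<le> c * (norm w)\<^sup>2 - \<bar>k e\<bar> * 1 - norm (g e) * norm w"
          using \<open>c \<ge> 0\<close> one_le_power[OF \<open>norm w \<ge> 1\<close>, of 2] self_le_power[OF \<open>norm w \<ge> 1\<close>, of 2]
          by (intro diff_mono mult_left_mono order_refl) auto
        also have "\<dots> \<le> q e s c x"
          using \<open>s > 0\<close> Cauchy_Schwarz_ineq2[of "g e" w] by (simp add: q_def w_def)
        finally show False
          using q_A \<open>\<not> norm e \<le> R\<close> by (simp add: R_def)
      qed
      note C = C[OF \<open>e \<in> E\<close> this] and d = d[OF \<open>e \<in> E\<close> this]
      show "h (x + v) + h (x - v) - 2 * h x \<le> \<epsilon>' * norm v + \<eta>'"
        \<comment> \<open>If \<open>c\<close> is large, then \<open>x\<close> is so close to \<open>e\<close> that the expansion of \<open>h\<close> at \<open>e\<close> applies instead.\<close>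
      proof (cases "c * norm v \<le> \<epsilon>")
        case True
        have "q e s c (x + v) + q e s c (x - v) - 2 * q e s c x = 2 * (c * norm v) * norm v"
          by (simp add: q_def power2_norm_eq_inner inner_simps algebra_simps inner_commute
              flip: power2_eq_square)
        also have "\<dots> \<le> 2 * \<epsilon> * norm v"
          using True by (intro mult_right_mono mult_left_mono) auto
        also have "\<dots> \<le> \<epsilon>' * norm v"
          using \<open>\<epsilon>' > 0\<close> by (intro mult_right_mono) (auto simp: \<epsilon>_def)
        finally show ?thesis
          using h_le[OF adm, of "x + v"] h_le[OF adm, of "x - v"] q_h \<eta> by linarith
      next
        case False
        then have "v \<noteq> 0" using \<open>\<epsilon> > 0\<close> by auto
        have cK: "c > K"
        proof (rule ccontr)
          assume "\<not> c > K"
          then have "c * norm v \<le> K * (\<epsilon> / (K + 1))"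
            using v \<open>K \<ge> 0\<close> by (intro mult_mono) (auto simp: \<delta>_def)
          also have "\<dots> \<le> \<epsilon>"
            using \<open>K \<ge> 0\<close> \<open>\<epsilon> > 0\<close> by (simp add: field_simps)
          finally show False using False by simp
        qed
        have gw: "\<bar>g e \<bullet> w\<bar> \<le> C * norm w"
          using C Cauchy_Schwarz_ineq2[of "g e" w] mult_right_mono[of "norm (g e)" C "norm w"] by simp
        have "norm w \<le> d / 2"
        proof (rule ccontr)
          assume "\<not> norm w \<le> d / 2"
          then have dw: "1 \<le> 2 / d * norm w"
            using \<open>d > 0\<close> by (simp add: field_simps)
          have "c * (norm w)\<^sup>2 \<le> \<bar>A\<bar> + C + C * norm w"
            using q_A \<open>s > 0\<close> C[THEN conjunct1] gw unfolding q_def w_def by linarith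
          also have "\<dots> \<le> (\<bar>A\<bar> + C) * (2 / d * norm w)\<^sup>2 + C * norm w * (2 / d * norm w)"
            using dw \<open>C \<ge> 0\<close> mult_left_mono[OF dw, of "C * norm w"]
              mult_left_mono[OF one_le_power[OF dw, of 2], of "\<bar>A\<bar> + C"] by simp
          also have "\<dots> = K * (norm w)\<^sup>2"
            by (simp add: K_def power2_eq_square algebra_simps)
          finally have "c \<le> K"
            using \<open>\<not> norm w \<le> d / 2\<close> \<open>d > 0\<close> by (auto simp: mult_le_cancel_right)
          then show False using cK by simp
        qed
        then have "norm (w + v) \<le> d" "norm (w - v) \<le> d"
          using v norm_triangle_ineq[of w v] norm_triangle_ineq4[of w v] by (auto simp: \<delta>_def)
        from d[OF this(1)] d[OF this(2)]
        have "h (x + v) + h (x - v) \<le> 2 * k e + 2 * (g e \<bullet> w) + \<epsilon> * (norm (w + v) + norm (w - v))"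
          by (simp add: w_def inner_simps algebra_simps)
        also have "\<dots> \<le> 2 * k e + 2 * (g e \<bullet> w) + \<epsilon> * (2 * norm w + 2 * norm v)"
          using \<open>\<epsilon> > 0\<close> norm_triangle_ineq[of w v] norm_triangle_ineq4[of w v]
          by (intro add_left_mono mult_left_mono) auto
        finally have 1: "h (x + v) + h (x - v) \<le> 2 * k e + 2 * (g e \<bullet> w) + 2 * \<epsilon> * norm w + 2 * \<epsilon> * norm v"
          by (simp add: algebra_simps)
        \<comment> \<open>The linear error \<open>\<epsilon> * norm w\<close> is absorbed by
          \<open>c * (norm w)\<^sup>2\<close>, which is already part of the value of the paraboloid
          at \<open>x\<close>. This uses \<open>c > \<epsilon> / norm v\<close> and the inequality
          of arithmetic and geometric means.\<close>
        have "\<epsilon> / norm v * (norm w)\<^sup>2 \<le> c * (norm w)\<^sup>2"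
          using False \<open>v \<noteq> 0\<close> by (intro mult_right_mono) (simp_all add: pos_divide_le_eq)
        moreover have "\<epsilon> * norm w \<le> \<epsilon> / norm v * (norm w)\<^sup>2 + \<epsilon> * norm v"
        proof -
          have "norm w * norm v \<le> (norm w)\<^sup>2 + (norm v)\<^sup>2"
            using sum_squares_bound[of "norm w" "norm v"]
              mult_nonneg_nonneg[OF norm_ge_zero norm_ge_zero, of w v] by linarith
          then have "norm w \<le> ((norm w)\<^sup>2 + (norm v)\<^sup>2) / norm v"
            using \<open>v \<noteq> 0\<close> by (simp add: pos_le_divide_eq)
          then have "\<epsilon> * norm w \<le> \<epsilon> * (((norm w)\<^sup>2 + (norm v)\<^sup>2) / norm v)"
            using \<open>\<epsilon> > 0\<close> by (intro mult_left_mono) auto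
          also have "\<dots> = \<epsilon> / norm v * (norm w)\<^sup>2 + \<epsilon> * norm v"
            using \<open>v \<noteq> 0\<close> by (simp add: field_simps power2_eq_square)
          finally show ?thesis .
        qed
        ultimately have 2: "\<epsilon> * norm w \<le> c * (norm w)\<^sup>2 + \<epsilon> * norm v"
          by simp
        have "k e + g e \<bullet> w + c * (norm w)\<^sup>2 \<le> h x + \<eta>"
          using q_h \<open>s > 0\<close> by (simp add: q_def w_def)
        with 1 2 have "h (x + v) + h (x - v) - 2 * h x \<le> 4 * \<epsilon> * norm v + 2 * \<eta>"
          by linarith
        then show ?thesis
          using \<eta> by (simp add: \<epsilon>_def)
      qed
    qed
    then show "\<exists>\<delta>>0. \<forall>x v. norm x \<le> \<rho> \<longrightarrow> norm v \<le> \<delta> \<longrightarrow> h (x + v) + h (x - v) - 2 * h x \<le> \<epsilon>' * norm v"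
      using \<open>\<delta> > 0\<close> by blast
  qed
  ultimately show ?thesis
    using k_h by blast
qed

lemma upper_smooth_GDERIV:
  fixes Q :: "'a::euclidean_space \<Rightarrow> real"
  assumes "\<And>x. GDERIV Q x :> DQ x" "continuous_on UNIV DQ"
  shows "upper_smooth Q"
  unfolding upper_smooth_def
proof (intro allI impI)
  fix R \<epsilon> :: real assume "\<epsilon> > 0"
  then obtain d where "d > 0" and d: "\<And>x u. norm x \<le> R \<Longrightarrow> norm u \<le> d \<Longrightarrow>
      \<bar>Q (x + u) - Q x - DQ x \<bullet> u\<bar> \<le> \<epsilon> / 2 * norm u"
    using GDERIV_uniform_on_cball[OF assms, of "\<epsilon> / 2" R] by auto
  have "Q (x + v) + Q (x - v) - 2 * Q x \<le> \<epsilon> * norm v" if "norm x \<le> R" "norm v \<le> d" for x v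
  proof -
    have "Q (x + v) - Q x - DQ x \<bullet> v \<le> \<epsilon> / 2 * norm v" "Q (x - v) - Q x + DQ x \<bullet> v \<le> \<epsilon> / 2 * norm v"
      using d[of x v] d[of x "- v"] that unfolding abs_le_iff by simp_all
    moreover have "\<epsilon> / 2 * norm v + \<epsilon> / 2 * norm v = \<epsilon> * norm v"
      by simp
    ultimately show ?thesis
      by linarith
  qed
  then show "\<exists>\<delta>>0. \<forall>x v. norm x \<le> R \<longrightarrow> norm v \<le> \<delta> \<longrightarrow> Q (x + v) + Q (x - v) - 2 * Q x \<le> \<epsilon> * norm v"
    using \<open>d > 0\<close> by blast
qed

lemma upper_smooth_add:
  assumes "upper_smooth f" "upper_smooth g"
  shows "upper_smooth (\<lambda>x. f x + g x)"
  unfolding upper_smooth_def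
proof (intro allI impI)
  fix R \<epsilon> :: real assume "\<epsilon> > 0"
  then have "\<epsilon> / 2 > 0" by simp
  obtain d where "d > 0" and d: "\<And>x v. norm x \<le> R \<Longrightarrow> norm v \<le> d \<Longrightarrow>
      f (x + v) + f (x - v) - 2 * f x \<le> \<epsilon> / 2 * norm v"
    using assms(1) \<open>\<epsilon> / 2 > 0\<close> unfolding upper_smooth_def by blast
  obtain d' where "d' > 0" and d': "\<And>x v. norm x \<le> R \<Longrightarrow> norm v \<le> d' \<Longrightarrow>
      g (x + v) + g (x - v) - 2 * g x \<le> \<epsilon> / 2 * norm v"
    using assms(2) \<open>\<epsilon> / 2 > 0\<close> unfolding upper_smooth_def by blast
  have "f (x + v) + g (x + v) + (f (x - v) + g (x - v)) - 2 * (f x + g x) \<le> \<epsilon> * norm v"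
    if "norm x \<le> R" "norm v \<le> min d d'" for x v
    using d[of x v] d'[of x v] that by (simp add: algebra_simps)
  then show "\<exists>\<delta>>0. \<forall>x v. norm x \<le> R \<longrightarrow> norm v \<le> \<delta> \<longrightarrow>
      f (x + v) + g (x + v) + (f (x - v) + g (x - v)) - 2 * (f x + g x) \<le> \<epsilon> * norm v"
    using \<open>d > 0\<close> \<open>d' > 0\<close> by (intro exI[of _ "min d d'"]) auto
qed

text \<open>Subtracting a C1 majorant \<open>Q\<close> makes \<open>m - Q\<close> nonpositive, and
  an upper smooth majorant \<open>h\<close> of the difference that agrees with it on
  \<open>E\<close> puts \<open>h + Q\<close> above \<open>m\<close>. The convex envelope of
  \<open>h + Q\<close> lies between \<open>m\<close> and \<open>h + Q\<close>, which coincide on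
  \<open>E\<close>.\<close>

theorem convex_smooth_majorant:
  fixes m :: "'a::euclidean_space \<Rightarrow> real" and G :: "'a \<Rightarrow> 'a"
  assumes conv: "convex_on UNIV m" and coer: "\<And>x. m x \<ge> a \<bullet> x + \<kappa> * norm x - C" and "\<kappa> > 0"
    and "E \<noteq> {}" and sub: "\<And>e y. e \<in> E \<Longrightarrow> m y \<ge> m e + G e \<bullet> (y - e)"
    and unif: "\<And>R \<epsilon>. \<epsilon> > 0 \<Longrightarrow> \<exists>\<delta>>0. \<forall>e\<in>E. norm e \<le> R \<longrightarrow>
        (\<forall>u. norm u \<le> \<delta> \<longrightarrow> m (e + u) \<le> m e + G e \<bullet> u + \<epsilon> * norm u)"
  shows "\<exists>F. convex_on UNIV F \<and> (\<forall>x. \<exists>g. GDERIV F x :> g) \<and> (\<forall>x. m x \<le> F x) \<and> (\<forall>e\<in>E. F e = m e)"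
proof -
  have m_cont: "continuous_on UNIV m"
    using conv by (intro convex_on_continuous) auto
  obtain Q DQ where Q: "\<And>x. GDERIV Q x :> DQ x" "continuous_on UNIV DQ" and m_Q: "\<And>x. m x \<le> Q x"
    using continuous_le_C1[OF m_cont] by auto
  have Q_cont: "continuous_on UNIV Q"
    using Q(1) unfolding gderiv_def
    by (intro continuous_at_imp_continuous_on ballI has_derivative_continuous)
  define k where "k x = m x - Q x" for x
  define g where "g e = G e - DQ e" for e
  have bdd_cball: "\<exists>B\<ge>0. \<forall>x. norm x \<le> R \<longrightarrow> norm (f x) \<le> B"
    if "continuous_on UNIV f" for f :: "'a \<Rightarrow> 'b::real_normed_vector" and R
  proof -
    have "bounded (f ` cball 0 R)"
      using that by (intro compact_imp_bounded compact_continuous_image) (auto intro: continuous_on_subset)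
    then obtain B where "B > 0" "\<And>x. x \<in> cball 0 R \<Longrightarrow> norm (f x) \<le> B"
      unfolding bounded_pos by auto
    then show ?thesis
      by (intro exI[of _ B]) auto
  qed
  have bdd: "\<exists>C\<ge>0. \<forall>e\<in>E. norm e \<le> R \<longrightarrow> \<bar>k e\<bar> \<le> C \<and> norm (g e) \<le> C" for R
  proof -
    obtain M where "M \<ge> 0" and M: "\<And>x. norm x \<le> R + 1 \<Longrightarrow> norm (m x) \<le> M"
      using bdd_cball[OF m_cont] by blast
    obtain N where "N \<ge> 0" and N: "\<And>x. norm x \<le> R \<Longrightarrow> norm (Q x) \<le> N"
      using bdd_cball[OF Q_cont] by blast
    obtain L where "L \<ge> 0" and L: "\<And>x. norm x \<le> R \<Longrightarrow> norm (DQ x) \<le> L"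
      using bdd_cball[OF Q(2)] by blast
    have "\<bar>k e\<bar> \<le> 2 * M + N + L \<and> norm (g e) \<le> 2 * M + N + L" if e: "e \<in> E" "norm e \<le> R" for e
    proof
      show "\<bar>k e\<bar> \<le> 2 * M + N + L"
        using M[of e] N[of e] e \<open>M \<ge> 0\<close> \<open>L \<ge> 0\<close> by (simp add: k_def)
      \<comment> \<open>A step of length at most 1 along \<open>G e\<close> turns the bound on
        \<open>m\<close> over the ball of radius \<open>R + 1\<close> into a bound on
        \<open>norm (G e)\<close>.\<close>
      have "norm (e + sgn (G e)) \<le> R + 1"
        using norm_triangle_ineq[of e "sgn (G e)"] e by (simp add: norm_sgn split: if_splits)
      then have "m (e + sgn (G e)) \<le> M" "- M \<le> m e"
        using M[of "e + sgn (G e)"] M[of e] e by auto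
      moreover have "G e \<bullet> sgn (G e) = norm (G e)"
        by (cases "G e = 0") (simp_all add: sgn_div_norm dot_square_norm power2_eq_square)
      ultimately have "norm (G e) \<le> 2 * M"
        using sub[OF e(1), of "e + sgn (G e)"] by simp
      then show "norm (g e) \<le> 2 * M + N + L"
        using norm_triangle_ineq4[of "G e" "DQ e"] L[OF e(2)] \<open>N \<ge> 0\<close> unfolding g_def by linarith
    qed
    then show ?thesis
      using \<open>M \<ge> 0\<close> \<open>N \<ge> 0\<close> \<open>L \<ge> 0\<close> by (intro exI[of _ "2 * M + N + L"]) auto
  qed
  have unif_k: "\<exists>\<delta>>0. \<forall>e\<in>E. norm e \<le> R \<longrightarrow>
        (\<forall>u. norm u \<le> \<delta> \<longrightarrow> k (e + u) \<le> k e + g e \<bullet> u + \<epsilon> * norm u)" if "\<epsilon> > 0" for R \<epsilon>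
  proof -
    have "\<epsilon> / 2 > 0" using that by simp
    obtain d where "d > 0" and d: "\<And>e u. e \<in> E \<Longrightarrow> norm e \<le> R \<Longrightarrow> norm u \<le> d \<Longrightarrow>
        m (e + u) \<le> m e + G e \<bullet> u + \<epsilon> / 2 * norm u"
      using unif[OF \<open>\<epsilon> / 2 > 0\<close>, of R] by blast
    obtain d' where "d' > 0" and d': "\<And>x u. norm x \<le> R \<Longrightarrow> norm u \<le> d' \<Longrightarrow>
        \<bar>Q (x + u) - Q x - DQ x \<bullet> u\<bar> \<le> \<epsilon> / 2 * norm u"
      using GDERIV_uniform_on_cball[OF Q \<open>\<epsilon> / 2 > 0\<close>, of R] by blast
    have "k (e + u) \<le> k e + g e \<bullet> u + \<epsilon> * norm u"
      if "e \<in> E" "norm e \<le> R" "norm u \<le> min d d'" for e u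
      using d[of e u] d'[of e u] that unfolding abs_le_iff
      by (simp add: k_def g_def inner_diff_left algebra_simps)
    then show ?thesis
      using \<open>d > 0\<close> \<open>d' > 0\<close> by (intro exI[of _ "min d d'"]) auto
  qed
  have "k x \<le> 0" for x
    using m_Q[of x] by (simp add: k_def)
  from upper_smooth_majorant[OF \<open>E \<noteq> {}\<close> this bdd unif_k]
  obtain h where "upper_smooth h" and h: "\<And>x. k x \<le> h x" "\<And>e. e \<in> E \<Longrightarrow> h e = k e"
    by blast
  have 1: "upper_smooth (\<lambda>x. h x + Q x)"
    using \<open>upper_smooth h\<close> upper_smooth_GDERIV[OF Q] by (rule upper_smooth_add)
  have 2: "m x \<le> h x + Q x" for x
    using h(1)[of x] by (simp add: k_def)
  from convex_envelope_GDERIV[OF 1 conv 2 coer \<open>\<kappa> > 0\<close>]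
  obtain F where F: "convex_on UNIV F" "\<forall>x. \<exists>g. GDERIV F x :> g" "\<forall>x. m x \<le> F x \<and> F x \<le> h x + Q x"
    by blast
  have "F e = m e" if "e \<in> E" for e
    using F(3)[rule_format, of e] h(2)[OF that] by (simp add: k_def)
  then show ?thesis
    using F(1,2) F(3)[THEN spec, THEN conjunct1] by (intro exI[of _ F] conjI ballI allI) simp_all
qed

section \<open>Orthogonal projections and coercivity\<close>

lemma orth_proj_eqI:
  assumes "subspace X" "y \<in> X" "x - y \<in> orthogonal_comp X"
  shows "orth_proj X x = y"
  unfolding orth_proj_def
proof (rule the_equality)
  fix z assume z: "z \<in> X \<and> x - z \<in> orthogonal_comp X"
  have "z - y \<in> X"
    using assms z by (simp add: subspace_diff)
  then have "(x - y) \<bullet> (z - y) = 0" "(x - z) \<bullet> (z - y) = 0"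
    using assms(3) z by (auto simp: orthogonal_comp_def orthogonal_def inner_commute)
  then have "(z - y) \<bullet> (z - y) = 0"
    by (simp add: inner_diff_left)
  then show "z = y" by simp
qed (use assms in simp)

lemma
  fixes x :: "real^'n"
  assumes "subspace X"
  shows orth_proj_in: "orth_proj X x \<in> X"
    and orth_proj_diff: "x - orth_proj X x \<in> orthogonal_comp X"
proof -
  obtain y z where yz: "y \<in> span X" "\<And>w. w \<in> span X \<Longrightarrow> orthogonal z w" "x = y + z"
    using orthogonal_subspace_decomp_exists[of X x] by blast
  have "y \<in> X"
    using yz(1) assms by (metis span_eq_iff)
  moreover have "x - y \<in> orthogonal_comp X"
    using yz(2,3) by (auto simp: orthogonal_comp_def orthogonal_commute span_base)
  ultimately show "orth_proj X x \<in> X" "x - orth_proj X x \<in> orthogonal_comp X"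
    using orth_proj_eqI[OF assms, of y x] by simp_all
qed

lemma linear_orth_proj:
  assumes "subspace (X :: (real^'n) set)"
  shows "linear (orth_proj X)"
proof (rule linearI)
  note P = orth_proj_in[OF assms] orth_proj_diff[OF assms]
  note oc = subspace_orthogonal_comp[of X]
  fix x y :: "real^'n" and c :: real
  show "orth_proj X (x + y) = orth_proj X x + orth_proj X y"
    using P subspace_add[OF oc P(2)[of x] P(2)[of y]] assms
    by (intro orth_proj_eqI[OF assms]) (auto simp: subspace_add algebra_simps)
  show "orth_proj X (c *\<^sub>R x) = c *\<^sub>R orth_proj X x"
    using P subspace_scale[OF oc P(2)[of x], of c] assms
    by (intro orth_proj_eqI[OF assms]) (auto simp: subspace_scale scaleR_diff_right)
qed

lemma orth_proj_id:
  assumes "subspace X" "x \<in> X"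
  shows "orth_proj X x = x"
  using assms by (intro orth_proj_eqI) (auto simp: orthogonal_comp_def orthogonal_def)

lemma orth_proj_orthogonal_comp:
  assumes "subspace X" "x \<in> orthogonal_comp X"
  shows "orth_proj X x = 0"
  using assms by (intro orth_proj_eqI) (auto simp: subspace_0)

lemma inner_orth_proj:
  assumes "subspace (X :: (real^'n) set)" "g \<in> X"
  shows "g \<bullet> orth_proj X x = g \<bullet> x"
proof -
  have "g \<bullet> (x - orth_proj X x) = 0"
    using orth_proj_diff[OF assms(1), of x] assms(2) by (auto simp: orthogonal_comp_def orthogonal_def)
  then show ?thesis by (simp add: inner_diff_right)
qed

lemma orth_proj_self_adjoint:
  assumes "subspace (X :: (real^'n) set)"
  shows "orth_proj X x \<bullet> y = x \<bullet> orth_proj X y"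
  using inner_orth_proj[OF assms orth_proj_in[OF assms], of x y]
    inner_orth_proj[OF assms orth_proj_in[OF assms], of y x] by (simp add: inner_commute)

lemma norm_orth_proj_le:
  assumes "subspace (X :: (real^'n) set)"
  shows "norm (orth_proj X x) \<le> norm x"
proof (cases "orth_proj X x = 0")
  case False
  have "orth_proj X x \<bullet> orth_proj X x = orth_proj X x \<bullet> x"
    by (rule inner_orth_proj[OF assms orth_proj_in[OF assms]])
  also have "\<dots> \<le> norm (orth_proj X x) * norm x"
    by (rule norm_cauchy_schwarz)
  finally show ?thesis
    using False by (simp add: dot_square_norm power2_eq_square)
qed simp

section \<open>Coercivity and the subspace it determines\<close>

text \<open>Take finitely many slopes whose differences span the space and centre them at their
  mean. Their values at a nonzero \<open>y\<close> sum to zero and do not all vanish, so one of them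
  is positive. Compactness of the unit sphere and homogeneity make this quantitative.\<close>

lemma span_differences_coercive:
  fixes S :: "'a::euclidean_space set"
  assumes "S \<noteq> {}"
  shows "\<exists>T a \<kappa>. finite T \<and> T \<subseteq> S \<and> \<kappa> > 0 \<and>
    (\<forall>y\<in>span {u - v |u v. u \<in> S \<and> v \<in> S}. \<exists>u\<in>T. u \<bullet> y \<ge> a \<bullet> y + \<kappa> * norm y)"
proof -
  define X where "X = span {u - v |u v. u \<in> S \<and> v \<in> S}"
  obtain s where "s \<in> S" using assms by blast
  obtain B where B: "B \<subseteq> (\<lambda>u. u - s) ` S" "independent B" "(\<lambda>u. u - s) ` S \<subseteq> span B"
    using maximal_independent_subset[of "(\<lambda>u. u - s) ` S"] by blast
  have "finite B" using B(2) by (rule independent_imp_finite)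
  have X_B: "X \<subseteq> span B"
    unfolding X_def
  proof (rule span_minimal)
    show "{u - v |u v. u \<in> S \<and> v \<in> S} \<subseteq> span B"
    proof clarsimp
      fix u v assume "u \<in> S" "v \<in> S"
      then have "(u - s) - (v - s) \<in> span B"
        using B(3) by (intro span_diff[of "u - s" B "v - s"]) blast+
      then show "u - v \<in> span B" by simp
    qed
  qed simp
  define T where "T = (\<lambda>b. b + s) ` insert 0 B"
  have "finite T" "T \<subseteq> S" "s \<in> T"
    using \<open>finite B\<close> B(1) \<open>s \<in> S\<close> by (auto simp: T_def)
  have "card T > 0"
    using \<open>finite T\<close> \<open>s \<in> T\<close> by (auto simp: card_gt_0_iff)
  define a where "a = (\<Sum>t\<in>T. t) /\<^sub>R real (card T)"
  have sum0: "(\<Sum>t\<in>T. (t - a) \<bullet> y) = 0" for y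
  proof -
    have "(\<Sum>t\<in>T. (t - a) \<bullet> y) = ((\<Sum>t\<in>T. t) - real (card T) *\<^sub>R a) \<bullet> y"
      by (simp add: inner_sum_left[symmetric] sum_subtractf sum_constant_scaleR)
    then show ?thesis
      using \<open>card T > 0\<close> by (simp add: a_def)
  qed
  \<comment> \<open>The sum of positive parts is continuous and positive at nonzero points of
    \<open>X\<close>; a lower bound \<open>c\<close> for it on the unit sphere leaves one of the
    \<open>card T\<close> summands with value at least \<open>c / card T\<close>.\<close>
  define \<phi> where "\<phi> y = (\<Sum>t\<in>T. max 0 ((t - a) \<bullet> y))" for y
  have \<phi>_pos: "\<phi> y > 0" if "y \<in> X" "y \<noteq> 0" for y
  proof (rule ccontr)
    assume "\<not> \<phi> y > 0"
    moreover have "\<phi> y \<ge> 0" by (auto simp: \<phi>_def intro: sum_nonneg)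
    ultimately have "\<phi> y = 0" by simp
    then have "max 0 ((t - a) \<bullet> y) = 0" if "t \<in> T" for t
      unfolding \<phi>_def using that \<open>finite T\<close> by (subst (asm) sum_nonneg_eq_0_iff) auto
    then have "- ((t - a) \<bullet> y) \<ge> 0" if "t \<in> T" for t
      using that by force
    moreover have "(\<Sum>t\<in>T. - ((t - a) \<bullet> y)) = 0"
      using sum0[of y] by (simp add: sum_negf)
    ultimately have eq: "- ((t - a) \<bullet> y) = 0" if "t \<in> T" for t
      using that \<open>finite T\<close> sum_nonneg_eq_0_iff[of T "\<lambda>t. - ((t - a) \<bullet> y)"] by blast
    have "b \<bullet> y = 0" if "b \<in> B" for b
      using eq[of "b + s"] eq[of s] that by (simp add: T_def algebra_simps)
    then have "orthogonal y b" if "b \<in> B" for b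
      using that by (simp add: orthogonal_def inner_commute)
    then have "orthogonal y y"
      using that(1) X_B by (intro orthogonal_to_span[of y B y]) auto
    then show False
      using that(2) by (simp add: orthogonal_def)
  qed
  have X_sub: "subspace X" by (simp add: X_def)
  define K where "K = X \<inter> sphere 0 1"
  obtain c where "c > 0" and c: "\<And>y. y \<in> K \<Longrightarrow> \<phi> y \<ge> c"
  proof (cases "K = {}")
    case False
    have "compact K"
      unfolding K_def using closed_subspace[OF X_sub] by (simp add: closed_Int_compact)
    moreover have "continuous_on K \<phi>"
      unfolding \<phi>_def by (intro continuous_intros)
    ultimately obtain z where "z \<in> K" "\<And>y. y \<in> K \<Longrightarrow> \<phi> z \<le> \<phi> y"
      using continuous_attains_inf[of K \<phi>] False by blast
    moreover have "\<phi> z > 0"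
      using \<phi>_pos[of z] \<open>z \<in> K\<close> by (cases "z = 0") (auto simp: K_def)
    ultimately show ?thesis using that by blast
  qed (use that[of 1] in auto)
  define \<kappa> where "\<kappa> = c / card T"
  have "\<kappa> > 0" using \<open>c > 0\<close> \<open>card T > 0\<close> by (simp add: \<kappa>_def)
  have "\<exists>u\<in>T. u \<bullet> y \<ge> a \<bullet> y + \<kappa> * norm y" if "y \<in> X" for y
  proof (cases "y = 0")
    case False
    define z where "z = y /\<^sub>R norm y"
    have "z \<in> K"
      using that False X_sub by (simp add: z_def K_def subspace_scale)
    have "\<exists>t\<in>T. (t - a) \<bullet> z \<ge> \<kappa>"
    proof (rule ccontr)
      assume "\<not> ?thesis"
      then have "max 0 ((t - a) \<bullet> z) < \<kappa>" if "t \<in> T" for t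
        using that \<open>\<kappa> > 0\<close> by force
      then have "\<phi> z < (\<Sum>t\<in>T. \<kappa>)"
        unfolding \<phi>_def using \<open>finite T\<close> \<open>s \<in> T\<close> by (intro sum_strict_mono) auto
      then show False
        using c[OF \<open>z \<in> K\<close>] \<open>card T > 0\<close> by (simp add: \<kappa>_def)
    qed
    then obtain t where "t \<in> T" "(t - a) \<bullet> z \<ge> \<kappa>" by blast
    then have "((t - a) \<bullet> z) * norm y \<ge> \<kappa> * norm y"
      by (intro mult_right_mono) auto
    moreover have "((t - a) \<bullet> z) * norm y = (t - a) \<bullet> y"
      using False by (simp add: z_def)
    ultimately have "(t - a) \<bullet> y \<ge> \<kappa> * norm y"
      by simp
    then show ?thesis
      using \<open>t \<in> T\<close> by (auto simp: inner_diff_left algebra_simps)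
  qed (use \<open>s \<in> T\<close> in auto)
  then show ?thesis
    using \<open>finite T\<close> \<open>T \<subseteq> S\<close> \<open>\<kappa> > 0\<close> unfolding X_def by blast
qed

text \<open>The right-hand side does not mention \<open>X\<close>, which yields uniqueness of the
  subspace. If \<open>F\<close> were affine along a \<open>u\<close> with nonzero projection
  \<open>w\<close>, then \<open>c - l\<close> would be affine along the line through
  \<open>w\<close> and could not tend to infinity at both ends.\<close>

lemma orthogonal_comp_eq_affine_directions:
  fixes X :: "(real^'n) set"
  assumes X: "subspace X" and "v \<in> orthogonal_comp X" and "essentially_coercive_on X c"
    and F: "\<And>x. F x = c (orth_proj X x) + v \<bullet> x"
  shows "orthogonal_comp X = {u. \<exists>a. \<forall>t. F (t *\<^sub>R u) = F 0 + t * a}"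
proof (intro antisym subsetI CollectI)
  note lin = linear_orth_proj[OF X]
  fix u assume "u \<in> orthogonal_comp X"
  then have "orth_proj X (t *\<^sub>R u) = 0" for t
    using X by (intro orth_proj_orthogonal_comp) (auto simp: subspace_scale subspace_orthogonal_comp)
  then have "F (t *\<^sub>R u) = F 0 + t * (v \<bullet> u)" for t
    by (simp add: F linear_0[OF lin])
  then show "\<exists>a. \<forall>t. F (t *\<^sub>R u) = F 0 + t * a" by blast
next
  note lin = linear_orth_proj[OF X]
  fix u assume "u \<in> {u. \<exists>a. \<forall>t. F (t *\<^sub>R u) = F 0 + t * a}"
  then obtain a where a: "\<And>t. F (t *\<^sub>R u) = F 0 + t * a" by blast
  obtain l where "linear l" and l: "\<And>x. (\<And>k. x k \<in> X) \<Longrightarrow> filterlim (\<lambda>k. norm (x k)) at_top sequentially \<Longrightarrow>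
      filterlim (\<lambda>k. c (x k) - l (x k)) at_top sequentially"
    using assms(3) unfolding essentially_coercive_on_def by blast
  define w where "w = orth_proj X u"
  define b where "b = a - v \<bullet> u - l w"
  have "w \<in> X" by (simp add: w_def orth_proj_in[OF X])
  have c: "c (t *\<^sub>R w) - l (t *\<^sub>R w) = F 0 + t * b" for t
    using a[of t] F[of "t *\<^sub>R u"] F[of 0]
    by (simp add: linear_scale[OF lin] linear_scale[OF \<open>linear l\<close>] w_def b_def algebra_simps)
  have "w = 0"
  proof (rule ccontr)
    assume "w \<noteq> 0"
    have at_top: "filterlim (\<lambda>k. F 0 + real k * s * b) at_top sequentially" if "\<bar>s\<bar> = 1" for s
    proof -
      have "filterlim (\<lambda>k. norm w * real k) at_top sequentially"
        using \<open>w \<noteq> 0\<close>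
        by (intro filterlim_tendsto_pos_mult_at_top[OF tendsto_const _ filterlim_real_sequentially]) simp
      then have "filterlim (\<lambda>k. norm ((real k * s) *\<^sub>R w)) at_top sequentially"
        using that by (simp add: abs_mult mult.commute)
      moreover have "(real k * s) *\<^sub>R w \<in> X" for k
        using X \<open>w \<in> X\<close> by (simp add: subspace_scale)
      ultimately show ?thesis
        using l[of "\<lambda>k. (real k * s) *\<^sub>R w"] by (simp only: c)
    qed
    define s :: real where "s = (if b \<le> 0 then 1 else -1)"
    have "\<bar>s\<bar> = 1" "s * b \<le> 0" by (auto simp: s_def)
    then have "eventually (\<lambda>k. F 0 + real k * s * b \<ge> F 0 + 1) sequentially"
      using at_top[of s] unfolding filterlim_at_top by blast
    then obtain k :: nat where "F 0 + real k * s * b \<ge> F 0 + 1"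
      unfolding eventually_sequentially by blast
    moreover have "real k * s * b \<le> 0"
      using \<open>s * b \<le> 0\<close> by (simp add: mult.assoc mult_nonneg_nonpos)
    ultimately show False by simp
  qed
  then show "u \<in> orthogonal_comp X"
    using orth_proj_diff[OF X, of u] by (simp add: w_def)
qed

section \<open>Convex functions with all gradient differences in a subspace\<close>

context
  fixes F :: "real^'n \<Rightarrow> real" and D :: "real^'n \<Rightarrow> real^'n" and X :: "(real^'n) set"
  assumes conv: "convex_on UNIV F" and D: "\<And>x. GDERIV F x :> D x"
    and X: "subspace X" and D_X: "\<And>x y. D x - D y \<in> X"
begin

lemma gradient_inner_orthogonal_comp:
  assumes "u \<in> orthogonal_comp X"
  shows "D y \<bullet> u = D 0 \<bullet> u"
proof -
  have "(D y - D 0) \<bullet> u = 0"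
    using assms D_X[of y 0] by (auto simp: orthogonal_comp_def orthogonal_def)
  then show ?thesis by (simp add: inner_diff_left)
qed

text \<open>The tangent planes at \<open>y\<close> and at \<open>y + u\<close> have the same slope
  along \<open>u\<close>, so their two inequalities pinch to an equality.\<close>

lemma convex_add_orthogonal_comp:
  assumes "u \<in> orthogonal_comp X"
  shows "F (y + u) = F y + D 0 \<bullet> u"
  using convex_on_GDERIV_ge[OF conv D[of y], of "y + u"] convex_on_GDERIV_ge[OF conv D[of "y + u"], of y]
    gradient_inner_orthogonal_comp[OF assms, of y] gradient_inner_orthogonal_comp[OF assms, of "y + u"]
  by simp

lemma convex_eq_orth_proj: "F x = F (orth_proj X x) + D 0 \<bullet> (x - orth_proj X x)"
  using convex_add_orthogonal_comp[OF orth_proj_diff[OF X], of "orth_proj X x" x] by simp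

text \<open>If the slopes differed by \<open>\<epsilon>\<close>, a step of fixed length
  \<open>d\<close> from \<open>x\<close> along \<open>D z - D x\<close> would lift a tangent plane
  at \<open>z\<close> that nearly touches at \<open>x\<close> above \<open>F\<close>. One
  \<open>d\<close> serves all \<open>x\<close> because, up to an affine term, \<open>F\<close> near
  \<open>x\<close> looks as it does near the projection, which stays in a ball.\<close>

lemma convex_gradient_gap:
  assumes "\<epsilon> > 0"
  shows "\<exists>\<delta>>0. \<forall>x z. norm (orth_proj X x) \<le> R \<longrightarrow> F x - F z - D z \<bullet> (x - z) < \<delta> \<longrightarrow> norm (D x - D z) < \<epsilon>"
proof -
  have "\<epsilon> / 3 > 0" using assms by simp
  obtain d where "d > 0" and d: "\<And>p u. norm p \<le> R \<Longrightarrow> norm u \<le> d \<Longrightarrow>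
      \<bar>F (p + u) - F p - D p \<bullet> u\<bar> \<le> \<epsilon> / 3 * norm u"
    using GDERIV_uniform_on_cball[OF D convex_on_GDERIV_continuous[OF conv D] \<open>\<epsilon> / 3 > 0\<close>, of R] by blast
  have "norm (D x - D z) < \<epsilon>"
    if x: "norm (orth_proj X x) \<le> R" and gap: "F x - F z - D z \<bullet> (x - z) < \<epsilon> / 3 * d" for x z
  proof (cases "D x = D z")
    case False
    define p where "p = orth_proj X x"
    have w: "x - p \<in> orthogonal_comp X"
      by (simp add: p_def orth_proj_diff[OF X])
    \<comment> \<open>\<open>D x\<close> supports \<open>F\<close> at \<open>p\<close> as well,
      since passing from \<open>x\<close> to \<open>p\<close> changes \<open>F\<close> and the
      tangent plane at \<open>x\<close> by the same amount.\<close>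
    have "D p = D x"
    proof (rule sym, rule GDERIV_eq_supporting[OF D])
      fix y
      show "F y \<ge> F p + D x \<bullet> (y - p)"
        using convex_on_GDERIV_ge[OF conv D[of x], of y] convex_add_orthogonal_comp[OF w, of p]
          gradient_inner_orthogonal_comp[OF w, of x] by (simp add: inner_diff_right)
    qed
    define n where "n = norm (D z - D x)"
    have "n > 0" using False by (simp add: n_def)
    define u where "u = (d / n) *\<^sub>R (D z - D x)"
    have "norm u = d"
      using \<open>d > 0\<close> \<open>n > 0\<close> by (simp add: u_def n_def)
    have "F (p + u) - F p - D p \<bullet> u \<le> \<epsilon> / 3 * d"
      using d[of p u] x \<open>norm u = d\<close> unfolding abs_le_iff p_def by simp
    moreover have "F (x + u) = F (p + u) + D 0 \<bullet> (x - p)" "F x = F p + D 0 \<bullet> (x - p)"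
      using convex_add_orthogonal_comp[OF w, of "p + u"] convex_add_orthogonal_comp[OF w, of p]
      by (simp_all add: algebra_simps)
    ultimately have "F (x + u) \<le> F x + D x \<bullet> u + \<epsilon> / 3 * d"
      using \<open>D p = D x\<close> by simp
    moreover have "F (x + u) \<ge> F z + D z \<bullet> (x - z) + D z \<bullet> u"
      using convex_on_GDERIV_ge[OF conv D[of z], of "x + u"] by (simp add: inner_simps algebra_simps)
    ultimately have "(D z - D x) \<bullet> u < 2 * (\<epsilon> / 3 * d)"
      using gap by (simp add: inner_diff_left)
    moreover have "(D z - D x) \<bullet> u = n * d"
      using \<open>n > 0\<close> by (simp add: u_def n_def dot_square_norm power2_eq_square)
    ultimately have "n * d < 2 * \<epsilon> / 3 * d" by simp
    then have "n < 2 * \<epsilon> / 3"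
      using \<open>d > 0\<close> by (simp only: mult_less_cancel_right_pos)
    then show ?thesis
      using assms by (simp add: n_def norm_minus_commute)
  qed (use assms in simp)
  moreover have "\<epsilon> / 3 * d > 0" using assms \<open>d > 0\<close> by simp
  ultimately show ?thesis by blast
qed

end

text \<open>Existence: \<open>F\<close> is affine with a fixed slope across the span, and finitely
  many tangent planes make it coercive there up to a linear term. Uniqueness: the affine directions
  of \<open>F\<close> determine the orthogonal complement, hence the subspace.\<close>

theorem coercivity_subspace_eq_span:
  fixes F :: "real^'n \<Rightarrow> real"
  assumes conv: "convex_on UNIV F" and D: "\<And>x. GDERIV F x :> D x"
  shows "coercivity_subspace F = span {D x - D y | x y. True}"
proof -
  define X where "X = span {D x - D y | x y. True}"
  have X: "subspace X" by (simp add: X_def)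
  have D_X: "D x - D y \<in> X" for x y
    unfolding X_def by (intro span_base) blast
  \<comment> \<open>The component of \<open>D 0\<close> orthogonal to \<open>X\<close>. It vanishes
    on \<open>X\<close>, so \<open>c\<close> can be \<open>F\<close> itself.\<close>
  define v where "v = D 0 - orth_proj X (D 0)"
  have v: "v \<in> orthogonal_comp X"
    by (simp add: v_def orth_proj_diff[OF X])
  define c where "c y = F y" for y
  have F: "F x = c (orth_proj X x) + v \<bullet> x" for x
  proof -
    have "D 0 \<bullet> (x - orth_proj X x) = v \<bullet> x"
      by (simp add: v_def inner_diff_left inner_diff_right orth_proj_self_adjoint[OF X])
    then show ?thesis
      using convex_eq_orth_proj[OF conv D X D_X, of x] by (simp add: c_def)
  qed
  have "essentially_coercive_on X c"
  proof -
    have span_eq: "span {u - v |u v. u \<in> range D \<and> v \<in> range D} = X"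
      unfolding X_def by (rule arg_cong[of _ _ span]) blast
    obtain T a \<kappa> where "finite T" "T \<subseteq> range D" "\<kappa> > 0"
      and T: "\<And>y. y \<in> X \<Longrightarrow> \<exists>u\<in>T. u \<bullet> y \<ge> a \<bullet> y + \<kappa> * norm y"
      using span_differences_coercive[of "range D", unfolded span_eq] UNIV_not_empty by blast
    define z where "z = inv D"
    have Dz: "D (z u) = u" if "u \<in> T" for u
      using that \<open>T \<subseteq> range D\<close> by (auto simp: z_def f_inv_into_f)
    define C where "C = (\<Sum>u\<in>T. \<bar>F (z u) - u \<bullet> z u\<bar>)"
    have le: "\<kappa> * norm y - C \<le> c y - a \<bullet> y" if y: "y \<in> X" for y
    proof -
      obtain u where "u \<in> T" and u: "u \<bullet> y \<ge> a \<bullet> y + \<kappa> * norm y"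
        using T[OF y] by blast
      have "\<bar>F (z u) - u \<bullet> z u\<bar> \<le> C"
        unfolding C_def using \<open>u \<in> T\<close> \<open>finite T\<close> by (intro member_le_sum) auto
      moreover have "F y \<ge> F (z u) + u \<bullet> (y - z u)"
        using convex_on_GDERIV_ge[OF conv D[of "z u"], of y] Dz[OF \<open>u \<in> T\<close>] by simp
      ultimately show ?thesis
        using u by (simp add: c_def inner_diff_right)
    qed
    show ?thesis
      unfolding essentially_coercive_on_def
    proof (intro exI[of _ "\<lambda>x. a \<bullet> x"] conjI allI impI)
      show "linear ((\<bullet>) a)"
        by (rule bounded_linear.linear[OF bounded_linear_inner_right])
      fix x :: "nat \<Rightarrow> real^'n"
      assume x: "(\<forall>k. x k \<in> X) \<and> filterlim (\<lambda>k. norm (x k)) at_top sequentially"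
      then have "filterlim (\<lambda>k. \<kappa> * norm (x k)) at_top sequentially"
        using \<open>\<kappa> > 0\<close> by (intro filterlim_tendsto_pos_mult_at_top[OF tendsto_const]) auto
      then have "filterlim (\<lambda>k. - C + \<kappa> * norm (x k)) at_top sequentially"
        by (rule filterlim_tendsto_add_at_top[OF tendsto_const])
      then show "filterlim (\<lambda>k. c (x k) - a \<bullet> x k) at_top sequentially"
        by (rule filterlim_at_top_mono) (use le x in \<open>auto intro!: always_eventually\<close>)
    qed
  qed
  note decomp = X v this F
  show ?thesis
    unfolding coercivity_subspace_def X_def[symmetric]
  proof (rule the_equality)
    show "subspace X \<and> (\<exists>v c. v \<in> X\<^sup>\<bottom> \<and> essentially_coercive_on X c \<and> (\<forall>x. F x = c (orth_proj X x) + v \<bullet> x))"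
      using decomp by blast
    fix Z
    assume Z: "subspace Z \<and> (\<exists>v c. v \<in> Z\<^sup>\<bottom> \<and> essentially_coercive_on Z c \<and> (\<forall>x. F x = c (orth_proj Z x) + v \<bullet> x))"
    then obtain v' c' where "v' \<in> Z\<^sup>\<bottom>" "essentially_coercive_on Z c'" "\<And>x. F x = c' (orth_proj Z x) + v' \<bullet> x"
      by blast
    then have "Z\<^sup>\<bottom> = X\<^sup>\<bottom>"
      using orthogonal_comp_eq_affine_directions[OF _ _ _ \<open>\<And>x. F x = c' (orth_proj Z x) + v' \<bullet> x\<close>] Z
        orthogonal_comp_eq_affine_directions[OF decomp] by simp
    then show "Z = X"
      using orthogonal_comp_self[OF X] orthogonal_comp_self[of Z] Z by metis
  qed
qed

section \<open>Extension of jets\<close>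

lemma convex_on_norm_power2: "convex_on UNIV (\<lambda>x::'a::real_inner. (norm x)\<^sup>2)"
proof (rule convex_onI)
  fix t :: real and x y :: 'a
  assume "0 < t" "t < 1"
  then have "0 \<le> t * (1 - t) * (norm (x - y))\<^sup>2" by simp
  also have "\<dots> = (1 - t) * (norm x)\<^sup>2 + t * (norm y)\<^sup>2 - (norm ((1 - t) *\<^sub>R x + t *\<^sub>R y))\<^sup>2"
    by (simp add: power2_norm_eq_inner inner_simps inner_commute algebra_simps)
  finally show "(norm ((1 - t) *\<^sub>R x + t *\<^sub>R y))\<^sup>2 \<le> (1 - t) * (norm x)\<^sup>2 + t * (norm y)\<^sup>2"
    by simp
qed simp

lemma convex_on_linear_compose:
  assumes "convex_on UNIV f" "linear L"
  shows "convex_on UNIV (\<lambda>x. f (L x))"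
  using assms unfolding convex_on_def by (simp add: linear_add linear_scale)

text \<open>The case in which the slopes on \<open>E\<close> span \<open>X\<close>. The supremum
  \<open>m\<close> of the prescribed planes is affine across \<open>X\<close>, so the problem
  descends to the projection of \<open>E\<close>. By \<open>superlin\<close>, steep planes are
  irrelevant over bounded projections; by \<open>gap\<close>, the upper expansion of
  \<open>m\<close> at \<open>E\<close> is uniform there.\<close>

theorem convex_C1_jet_extension:
  fixes E X :: "(real^'n) set" and f :: "real^'n \<Rightarrow> real" and G :: "real^'n \<Rightarrow> real^'n"
  assumes "E \<noteq> {}" and X: "X = span {G x - G y | x y. x \<in> E \<and> y \<in> E}"
    and conv: "\<And>x y. x \<in> E \<Longrightarrow> y \<in> E \<Longrightarrow> f x \<ge> f y + G y \<bullet> (x - y)"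
    and superlin: "\<And>R. \<exists>M. \<forall>z\<in>E. norm (G z) \<ge> M \<longrightarrow> G z \<bullet> z - f z \<ge> R * norm (G z)"
    and gap: "\<And>R \<epsilon>. \<epsilon> > 0 \<Longrightarrow> \<exists>\<delta>>0. \<forall>x\<in>E. \<forall>z\<in>E. norm (orth_proj X x) \<le> R \<and> norm (G z) \<le> R \<and>
        f x - f z - G z \<bullet> (x - z) < \<delta> \<longrightarrow> norm (G x - G z) \<le> \<epsilon>"
  shows "\<exists>F. convex_on UNIV F \<and> C1_function F \<and> (\<forall>x\<in>E. F x = f x \<and> GDERIV F x :> G x) \<and>
    coercivity_subspace F = X"
proof -
  define P where "P = orth_proj X"
  have sub: "subspace X" by (simp add: X)
  have lin: "linear P"
    unfolding P_def by (rule linear_orth_proj[OF sub])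
  note P_in = orth_proj_in[OF sub, folded P_def] and P_diff = orth_proj_diff[OF sub, folded P_def]
    and P_inner = inner_orth_proj[OF sub, folded P_def]
    and P_adj = orth_proj_self_adjoint[OF sub, folded P_def]
    and P_norm = norm_orth_proj_le[OF sub, folded P_def] and P_id = orth_proj_id[OF sub, folded P_def]
  obtain z0 where z0: "z0 \<in> E" using \<open>E \<noteq> {}\<close> by blast
  define v where "v = G z0"
  have G_v: "G z - v \<in> X" if "z \<in> E" for z
    unfolding X v_def using that z0 by (intro span_base) blast
  have G_orth: "G z \<bullet> u = v \<bullet> u" if "z \<in> E" "u \<in> orthogonal_comp X" for z u
  proof -
    have "(G z - v) \<bullet> u = 0"
      using that G_v[OF that(1)] by (auto simp: orthogonal_comp_def orthogonal_def)
    then show ?thesis by (simp add: inner_diff_left)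
  qed
  define l where "l z y = f z + G z \<bullet> (y - z)" for z y
  have l_add: "l z (y + u) = l z y + G z \<bullet> u" for z y u
    by (simp add: l_def inner_simps)
  \<comment> \<open>Where \<open>P y\<close> is bounded, steep planes stay below the plane at
    \<open>z0\<close> by a margin of 1. Only \<open>P y\<close> matters, since all slopes agree on
    the orthogonal complement.\<close>
  have large: "\<exists>M>0. \<forall>z\<in>E. \<forall>y. norm (P y) \<le> R \<longrightarrow> norm (G z) \<ge> M \<longrightarrow> l z y \<le> l z0 y - 1" for R
  proof -
    define R' where "R' = max R 0"
    obtain M1 where M1: "\<And>z. z \<in> E \<Longrightarrow> norm (G z) \<ge> M1 \<Longrightarrow> G z \<bullet> z - f z \<ge> (R' + 1) * norm (G z)"
      using superlin by blast
    define M where "M = max 1 (max M1 (norm v * R' - f z0 + v \<bullet> z0 + 1))"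
    have "l z y \<le> l z0 y - 1" if "z \<in> E" "norm (P y) \<le> R" "norm (G z) \<ge> M" for z y
    proof -
      have "(G z - v) \<bullet> y = (G z - v) \<bullet> P y"
        using P_inner[OF G_v[OF that(1)]] by simp
      also have "\<dots> \<le> norm (G z - v) * norm (P y)"
        by (rule norm_cauchy_schwarz)
      also have "\<dots> \<le> (norm (G z) + norm v) * R'"
        using that(2) norm_triangle_ineq4[of "G z" v] by (intro mult_mono) (auto simp: R'_def)
      finally have "G z \<bullet> y - v \<bullet> y \<le> (norm (G z) + norm v) * R'"
        by (simp add: inner_diff_left)
      moreover have "G z \<bullet> z - f z \<ge> (R' + 1) * norm (G z)"
        using that by (intro M1) (auto simp: M_def)
      moreover have "norm (G z) \<ge> norm v * R' - f z0 + v \<bullet> z0 + 1"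
        using that by (simp add: M_def)
      ultimately show ?thesis
        by (simp add: l_def inner_diff_right algebra_simps v_def)
    qed
    then show ?thesis
      by (intro exI[of _ M]) (auto simp: M_def)
  qed
  define m where "m y = (SUP z\<in>E. l z y)" for y
  \<comment> \<open>Steep planes are below \<open>l z0\<close>; the others have slope at most
    \<open>M\<close> and value at most \<open>f z0\<close> at \<open>z0\<close>.\<close>
  have bdd: "bdd_above ((\<lambda>z. l z y) ` E)" for y
  proof -
    obtain M where "M > 0" and M: "\<And>z. z \<in> E \<Longrightarrow> norm (G z) \<ge> M \<Longrightarrow> l z y \<le> l z0 y - 1"
      using large[of "norm (P y)"] by blast
    have "l z y \<le> max (l z0 y) (f z0 + M * norm (y - z0))" if "z \<in> E" for z
    proof (cases "norm (G z) \<ge> M")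
      case False
      have "l z y = l z z0 + G z \<bullet> (y - z0)"
        using l_add[of z z0 "y - z0"] by simp
      also have "l z z0 \<le> f z0"
        using conv[OF z0 that] by (simp add: l_def)
      also have "G z \<bullet> (y - z0) \<le> norm (G z) * norm (y - z0)"
        by (rule norm_cauchy_schwarz)
      also have "\<dots> \<le> M * norm (y - z0)"
        using False by (intro mult_right_mono) auto
      finally show ?thesis by simp
    qed (use M[OF that] in auto)
    then show ?thesis
      by (intro bdd_aboveI2) 
  qed
  have l_le: "l z y \<le> m y" if "z \<in> E" for z y
    unfolding m_def using that bdd by (rule cSUP_upper)
  have m_le: "m y \<le> b" if "\<And>z. z \<in> E \<Longrightarrow> l z y \<le> b" for y b
    unfolding m_def using that \<open>E \<noteq> {}\<close> by (intro cSUP_least)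
  have m_f: "m x = f x" if "x \<in> E" for x
    using l_le[OF that, of x] conv[OF that] by (intro antisym m_le) (auto simp: l_def)
  have m_conv: "convex_on UNIV m"
  proof (rule convex_onI)
    fix t :: real and x y :: "real^'n"
    assume t: "0 < t" "t < 1"
    show "m ((1 - t) *\<^sub>R x + t *\<^sub>R y) \<le> (1 - t) * m x + t * m y"
    proof (rule m_le)
      fix z assume "z \<in> E"
      have "l z ((1 - t) *\<^sub>R x + t *\<^sub>R y) = (1 - t) * l z x + t * l z y"
        by (simp add: l_def inner_simps algebra_simps)
      also have "\<dots> \<le> (1 - t) * m x + t * m y"
        using t \<open>z \<in> E\<close> by (intro add_mono mult_left_mono l_le) auto
      finally show "l z ((1 - t) *\<^sub>R x + t *\<^sub>R y) \<le> (1 - t) * m x + t * m y" .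
    qed
  qed simp
  have m_add: "m (y + u) = m y + v \<bullet> u" if "u \<in> orthogonal_comp X" for y u
  proof -
    have *: "m (y + u) \<le> m y + v \<bullet> u" if "u \<in> orthogonal_comp X" for y u
      using that l_le by (intro m_le) (simp add: l_add G_orth)
    have "- u \<in> orthogonal_comp X"
      using that subspace_neg[OF subspace_orthogonal_comp] by blast
    from *[OF this, of "y + u"] *[OF that, of y] show ?thesis by simp
  qed
  \<comment> \<open>Three kinds of planes compete at \<open>x + u\<close>. Steep ones are too low by
    1, flatter ones with a gap of at least \<open>d\<close> at \<open>x\<close> are too low by
    \<open>d\<close>, and neither can catch up within distance \<open>\<delta>\<close>. The
    remaining ones have slopes within \<open>\<epsilon>\<close> of \<open>G x\<close>.\<close>
  have m_unif: "\<exists>\<delta>>0. \<forall>x\<in>E. norm (P x) \<le> R \<longrightarrow> (\<forall>u. norm u \<le> \<delta> \<longrightarrow> m (x + u) \<le> f x + G x \<bullet> u + \<epsilon> * norm u)"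
    if "\<epsilon> > 0" for R \<epsilon>
  proof -
    obtain M where "M > 0" and M: "\<And>z y. z \<in> E \<Longrightarrow> norm (P y) \<le> R + 1 \<Longrightarrow> norm (G z) \<ge> M \<Longrightarrow> l z y \<le> l z0 y - 1"
      using large[of "R + 1"] by blast
    obtain d where "d > 0" and d: "\<And>x z. x \<in> E \<Longrightarrow> z \<in> E \<Longrightarrow> norm (P x) \<le> max R M \<Longrightarrow> norm (G z) \<le> max R M \<Longrightarrow>
        f x - f z - G z \<bullet> (x - z) < d \<Longrightarrow> norm (G x - G z) \<le> \<epsilon>"
      using gap[OF \<open>\<epsilon> > 0\<close>, of "max R M"] unfolding P_def by blast
    define \<delta> where "\<delta> = min 1 (min (1 / (norm v + M)) (d / (2 * M)))"
    have "norm v + M > 0"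
      using \<open>M > 0\<close> by (simp add: add_nonneg_pos)
    then have "\<delta> > 0"
      using \<open>d > 0\<close> \<open>M > 0\<close> by (simp add: \<delta>_def)
    have "m (x + u) \<le> f x + G x \<bullet> u + \<epsilon> * norm u"
      if x: "x \<in> E" "norm (P x) \<le> R" and u: "norm u \<le> \<delta>" for x u
    proof (rule m_le)
      fix z assume z: "z \<in> E"
      have "norm u \<le> 1" "norm u \<le> 1 / (norm v + M)" "norm u \<le> d / (2 * M)"
        using u by (simp_all add: \<delta>_def)
      then have u1: "(norm v + M) * norm u \<le> 1" and u2: "2 * M * norm u \<le> d"
        using \<open>M > 0\<close> \<open>norm v + M > 0\<close> by (simp_all add: pos_le_divide_eq mult.commute)
      have l_f: "l w x \<le> f x" if "w \<in> E" for w
        using conv[OF x(1) that] by (simp add: l_def)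
      \<comment> \<open>The plane of \<open>x\<close> itself is the highest one at \<open>x\<close>,
        so it cannot be steep.\<close>
      have "norm (G x) < M"
      proof (rule ccontr)
        assume "\<not> norm (G x) < M"
        then have "l x x \<le> l z0 x - 1"
          using x by (intro M) auto
        then show False
          using l_f[OF z0] by (simp add: l_def)
      qed
      have Gu: "\<bar>G w \<bullet> u\<bar> \<le> norm (G w) * norm u" for w
        by (rule Cauchy_Schwarz_ineq2)
      have GxM: "norm (G x) * norm u \<le> M * norm u"
        using \<open>norm (G x) < M\<close> by (intro mult_right_mono) auto
      have eu: "\<epsilon> * norm u \<ge> 0" using \<open>\<epsilon> > 0\<close> by simp
      show "l z (x + u) \<le> f x + G x \<bullet> u + \<epsilon> * norm u"
      proof (cases "norm (G z) \<ge> M")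
        case True
        have "norm (P (x + u)) \<le> R + 1"
          using norm_triangle_ineq[of "P x" "P u"] P_norm[of u] x \<open>norm u \<le> 1\<close>
          by (simp add: linear_add[OF lin])
        then have "l z (x + u) \<le> l z0 x + v \<bullet> u - 1"
          using M[OF z _ True, of "x + u"] by (simp add: l_add v_def)
        then show ?thesis
          using l_f[OF z0] Gu[of x] Gu[of z0] GxM u1 eu
          unfolding v_def distrib_right abs_le_iff by linarith
      next
        case False
        have GzM: "norm (G z) * norm u \<le> M * norm u"
          using False by (intro mult_right_mono) auto
        show ?thesis
        proof (cases "f x - l z x < d")
          case True
          then have "norm (G x - G z) \<le> \<epsilon>"
            using x z False by (intro d) (auto simp: l_def)
          then have "(G z - G x) \<bullet> u \<le> \<epsilon> * norm u"
            using norm_cauchy_schwarz[of "G z - G x" u] mult_right_mono[of "norm (G x - G z)" \<epsilon> "norm u"]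
            by (simp add: norm_minus_commute)
          then show ?thesis
            using l_f[OF z] by (simp add: l_add inner_diff_left)
        next
          case False
          then show ?thesis
            using Gu[of x] Gu[of z] GxM GzM u2 eu unfolding l_add abs_le_iff by linarith
        qed
      qed
    qed
    then show ?thesis
      using \<open>\<delta> > 0\<close> by blast
  qed
  \<comment> \<open>The square makes \<open>M\<close> coercive also across \<open>X\<close>; composing the majorant with \<open>P\<close> removes it again.\<close>
  define M where "M y = m y - v \<bullet> y + (norm (y - P y))\<^sup>2" for y
  have M_conv: "convex_on UNIV M"
  proof -
    have 1: "convex_on UNIV (\<lambda>y. (norm (y - P y))\<^sup>2)"
      using lin by (intro convex_on_linear_compose[OF convex_on_norm_power2] linear_compose_sub) (auto intro: linear_id[unfolded id_def])
    have 2: "convex_on UNIV (\<lambda>y. - (v \<bullet> y))"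
      by (intro convex_onI) (simp_all add: inner_simps algebra_simps)
    have "M = (\<lambda>y. m y + - (v \<bullet> y) + (norm (y - P y))\<^sup>2)"
      by (simp add: M_def fun_eq_iff)
    then show ?thesis
      using convex_on_add[OF convex_on_add[OF m_conv 2] 1] by simp
  qed
  obtain a \<kappa> C where "\<kappa> > 0" and M_coer: "\<And>y. M y \<ge> a \<bullet> y + \<kappa> * norm y - C"
  proof -
    have span_eq: "span {u - v |u v. u \<in> G ` E \<and> v \<in> G ` E} = X"
      unfolding X by (rule arg_cong[of _ _ span]) blast
    have "G ` E \<noteq> {}" using \<open>E \<noteq> {}\<close> by simp
    from span_differences_coercive[OF this, unfolded span_eq]
    obtain T a \<kappa> where "finite T" "T \<subseteq> G ` E" "\<kappa> > 0"
      and T: "\<And>y. y \<in> X \<Longrightarrow> \<exists>u\<in>T. u \<bullet> y \<ge> a \<bullet> y + \<kappa> * norm y"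
      by blast
    define z where "z = inv_into E G"
    have Gz: "G (z u) = u" "z u \<in> E" if "u \<in> T" for u
      using that \<open>T \<subseteq> G ` E\<close> by (auto simp: z_def f_inv_into_f inv_into_into subset_iff)
    define C where "C = (\<Sum>u\<in>T. \<bar>f (z u) - u \<bullet> z u\<bar>)"
    have m_ge: "m y \<ge> a \<bullet> y + \<kappa> * norm y - C" if y: "y \<in> X" for y
    proof -
      obtain u where "u \<in> T" and u: "u \<bullet> y \<ge> a \<bullet> y + \<kappa> * norm y"
        using T[OF y] by blast
      have "\<bar>f (z u) - u \<bullet> z u\<bar> \<le> C"
        unfolding C_def using \<open>u \<in> T\<close> \<open>finite T\<close> by (intro member_le_sum) auto
      moreover have "m y \<ge> f (z u) + u \<bullet> (y - z u)"
        using l_le[OF Gz(2)[OF \<open>u \<in> T\<close>], of y] Gz(1)[OF \<open>u \<in> T\<close>] by (simp add: l_def)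
      ultimately show ?thesis
        using u by (simp add: inner_diff_right)
    qed
    \<comment> \<open>Growth along \<open>X\<close> comes from the finitely many slopes in
      \<open>T\<close>; across \<open>X\<close> the square exceeds
      \<open>\<kappa> * norm (y - P y)\<close> up to the constant
      \<open>\<kappa>\<^sup>2\<close>.\<close>
    have "M y \<ge> P (a - v) \<bullet> y + \<kappa> * norm y - (C + \<kappa>\<^sup>2)" for y
    proof -
      have "m y - v \<bullet> y = m (P y) - v \<bullet> P y"
        using m_add[OF P_diff[of y], of "P y"] by (simp add: inner_diff_right)
      also have "\<dots> \<ge> (a - v) \<bullet> P y + \<kappa> * norm (P y) - C"
        using m_ge[OF P_in[of y]] by (simp add: inner_diff_left)
      finally have "m y - v \<bullet> y \<ge> P (a - v) \<bullet> y + \<kappa> * norm (P y) - C"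
        by (simp add: P_adj)
      moreover have "\<kappa> * norm (y - P y) \<le> (norm (y - P y))\<^sup>2 + \<kappa>\<^sup>2"
      proof -
        have "2 * (\<kappa> * norm (y - P y)) \<le> (norm (y - P y))\<^sup>2 + \<kappa>\<^sup>2"
          using sum_squares_bound[of \<kappa> "norm (y - P y)"] by simp
        moreover have "\<kappa> * norm (y - P y) \<ge> 0" using \<open>\<kappa> > 0\<close> by simp
        ultimately show ?thesis by linarith
      qed
      moreover have "\<kappa> * norm y \<le> \<kappa> * (norm (P y) + norm (y - P y))"
        using norm_triangle_ineq[of "P y" "y - P y"] \<open>\<kappa> > 0\<close> by (intro mult_left_mono) auto
      ultimately show ?thesis
        unfolding M_def distrib_left by linarith
    qed
    then show ?thesis
      using that \<open>\<kappa> > 0\<close> by blast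
  qed
  \<comment> \<open>Several points of \<open>E\<close> may share a projection, and one of them is
    picked. \<open>M (P x)\<close> does not depend on the choice, and the slopes at the other points
    are recovered at the end from differentiability.\<close>
  define r where "r = inv_into E P"
  have r: "r e \<in> E" "P (r e) = e" if "e \<in> P ` E" for e
    using that by (auto simp: r_def inv_into_into f_inv_into_f)
  define G' where "G' e = G (r e) - v" for e
  have M_P: "M (P x) = f x - v \<bullet> x" if "x \<in> E" for x
    using m_add[OF P_diff[of x], of "P x"] m_f[OF that] P_id[OF P_in[of x]]
    by (simp add: M_def inner_diff_right)
  have M_sub: "M y \<ge> M e + G' e \<bullet> (y - e)" if "e \<in> P ` E" for e y
  proof -
    define x where "x = r e"
    have x: "x \<in> E" "e = P x" using r[OF that] by (simp_all add: x_def)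
    have "M y \<ge> m y - v \<bullet> y" by (simp add: M_def)
    moreover have "m y \<ge> f x + G x \<bullet> (y - x)"
      using l_le[OF x(1), of y] by (simp add: l_def)
    ultimately have "M y \<ge> f x - v \<bullet> x + (G x - v) \<bullet> (y - x)"
      by (simp add: inner_simps)
    moreover have "(G x - v) \<bullet> (y - x) = G' e \<bullet> (y - e)"
    proof -
      have "G' e = G x - v" by (simp add: G'_def x_def)
      then show ?thesis
        using P_inner[OF G_v[OF x(1)], of x] unfolding x(2) inner_diff_right by simp
    qed
    ultimately show ?thesis
      using M_P[OF x(1)] x(2) by simp
  qed
  have M_unif: "\<exists>\<delta>>0. \<forall>e\<in>P ` E. norm e \<le> R \<longrightarrow>
      (\<forall>u. norm u \<le> \<delta> \<longrightarrow> M (e + u) \<le> M e + G' e \<bullet> u + \<epsilon> * norm u)" if "\<epsilon> > 0" for R \<epsilon>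
  proof -
    have "\<epsilon> / 2 > 0" using that by simp
    obtain d where "d > 0" and d: "\<And>x u. x \<in> E \<Longrightarrow> norm (P x) \<le> R \<Longrightarrow> norm u \<le> d \<Longrightarrow>
        m (x + u) \<le> f x + G x \<bullet> u + \<epsilon> / 2 * norm u"
      using m_unif[OF \<open>\<epsilon> / 2 > 0\<close>, of R] by blast
    have "M (e + u) \<le> M e + G' e \<bullet> u + \<epsilon> * norm u"
      if e: "e \<in> P ` E" "norm e \<le> R" and u: "norm u \<le> min d (\<epsilon> / 8)" for e u
    proof -
      define x where "x = r e"
      have x: "x \<in> E" "P x = e" using r[OF e(1)] by (simp_all add: x_def)
      have "m (x + u) = m (e + u) + v \<bullet> x - v \<bullet> e"
        using m_add[OF P_diff[of x], of "e + u"] unfolding x(2) by (simp add: inner_diff_right add.commute)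
      moreover have "m (x + u) \<le> f x + G x \<bullet> u + \<epsilon> / 2 * norm u"
        using d[of x u] x e u by simp
      moreover have "M e = f x - v \<bullet> x"
        using M_P[OF x(1)] x(2) by simp
      moreover have "M (e + u) = m (e + u) - v \<bullet> e - v \<bullet> u + (norm (u - P u))\<^sup>2"
      proof -
        have eq: "e + u - P (e + u) = u - P u"
          using P_id[OF P_in[of x]] x(2) by (simp add: linear_add[OF lin])
        show ?thesis
          unfolding M_def eq inner_add_right by simp
      qed
      \<comment> \<open>The added square is of second order: for
        \<open>norm u \<le> \<epsilon> / 8\<close> it takes at most half of the allowed
        error.\<close>
      moreover have "(norm (u - P u))\<^sup>2 \<le> \<epsilon> / 2 * norm u"
      proof -
        have "norm (u - P u) \<le> 2 * norm u"
          using norm_triangle_ineq4[of u "P u"] P_norm[of u] by simp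
        then have "(norm (u - P u))\<^sup>2 \<le> (2 * norm u)\<^sup>2"
          by (intro power_mono) auto
        also have "\<dots> = 4 * norm u * norm u"
          by (simp add: power2_eq_square)
        also have "\<dots> \<le> \<epsilon> / 2 * norm u"
          using u by (intro mult_right_mono) auto
        finally show ?thesis .
      qed
      moreover have "\<epsilon> * norm u = \<epsilon> / 2 * norm u + \<epsilon> / 2 * norm u" by simp
      moreover have "G' e \<bullet> u = G x \<bullet> u - v \<bullet> u"
        by (simp add: G'_def x_def inner_diff_left)
      ultimately show ?thesis by linarith
    qed
    then show ?thesis
      using \<open>d > 0\<close> \<open>\<epsilon> > 0\<close> by (intro exI[of _ "min d (\<epsilon> / 8)"]) auto
  qed
  have "P ` E \<noteq> {}" using \<open>E \<noteq> {}\<close> by simp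
  from convex_smooth_majorant[OF M_conv M_coer \<open>\<kappa> > 0\<close> this M_sub M_unif]
  obtain H where H: "convex_on UNIV H" "\<And>x. \<exists>g. GDERIV H x :> g" "\<And>x. M x \<le> H x" "\<And>e. e \<in> P ` E \<Longrightarrow> H e = M e"
    by blast
  obtain DH where DH: "\<And>x. GDERIV H x :> DH x"
    using H(2) by metis
  define F where "F x = H (P x) + v \<bullet> x" for x
  define D where "D x = P (DH (P x)) + v" for x
  have F_conv: "convex_on UNIV F"
  proof -
    have "convex_on UNIV (\<lambda>x. v \<bullet> x)"
      by (intro convex_onI) (simp_all add: inner_simps)
    then show ?thesis
      unfolding F_def by (intro convex_on_add convex_on_linear_compose[OF H(1) lin])
  qed
  have F_D: "GDERIV F x :> D x" for x
  proof -
    have "(P has_derivative P) (at x)"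
      by (rule linear_imp_has_derivative[OF lin])
    moreover have "(H has_derivative (\<lambda>h. h \<bullet> DH (P x))) (at (P x))"
      using DH[of "P x"] by (simp only: gderiv_def)
    ultimately have "((\<lambda>x. H (P x)) has_derivative (\<lambda>h. P h \<bullet> DH (P x))) (at x)"
      by (rule has_derivative_compose)
    then have "((\<lambda>x. H (P x) + v \<bullet> x) has_derivative (\<lambda>h. P h \<bullet> DH (P x) + v \<bullet> h)) (at x)"
      by (intro has_derivative_add has_derivative_inner_right has_derivative_ident)
    moreover have "P h \<bullet> DH (P x) + v \<bullet> h = h \<bullet> D x" for h
      by (simp add: D_def inner_add_right P_adj inner_commute[of v])
    ultimately show ?thesis
      unfolding gderiv_def F_def by simp
  qed
  have F_f: "F x = f x" if "x \<in> E" for x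
    using H(4)[of "P x"] M_P[OF that] that by (simp add: F_def)
  \<comment> \<open>\<open>F\<close> lies above \<open>m\<close>, hence above each prescribed plane,
    and meets that plane at its base point.\<close>
  have D_G: "D x = G x" if "x \<in> E" for x
  proof (rule sym, rule GDERIV_eq_supporting[OF F_D])
    fix y
    have "F y \<ge> M (P y) + v \<bullet> y"
      using H(3)[of "P y"] by (simp add: F_def)
    moreover have "M (P y) + v \<bullet> y = m y"
      using m_add[OF P_diff[of y], of "P y"] P_id[OF P_in[of y]] by (simp add: M_def inner_diff_right)
    moreover have "m y \<ge> f x + G x \<bullet> (y - x)"
      using l_le[OF that, of y] by (simp add: l_def)
    ultimately show "F y \<ge> F x + G x \<bullet> (y - x)"
      by (simp add: F_f[OF that])
  qed
  have "coercivity_subspace F = X"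
    unfolding coercivity_subspace_eq_span[OF F_conv F_D]
  proof
    show "span {D x - D y |x y. True} \<subseteq> X"
      using P_in sub by (intro span_minimal) (auto simp: D_def subspace_diff)
    have "{G x - G y |x y. x \<in> E \<and> y \<in> E} \<subseteq> {D x - D y |x y. True}"
      using D_G by auto metis
    then show "X \<subseteq> span {D x - D y |x y. True}"
      unfolding X by (rule span_mono)
  qed
  moreover have "C1_function F"
    unfolding C1_function_def using F_D convex_on_GDERIV_continuous[OF F_conv F_D] by blast
  moreover have "\<forall>x\<in>E. F x = f x \<and> GDERIV F x :> G x"
    using F_f F_D D_G by metis
  ultimately show ?thesis
    using F_conv by blast
qed

section \<open>Completing the span of the gradients\<close>

lemma finite_uniform_pos:
  fixes Q :: "'i \<Rightarrow> real \<Rightarrow> bool"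
  assumes "finite I" and "\<And>i. i \<in> I \<Longrightarrow> \<exists>d>0. Q i d"
    and mono: "\<And>i d d'. Q i d \<Longrightarrow> 0 < d' \<Longrightarrow> d' \<le> d \<Longrightarrow> Q i d'"
  shows "\<exists>d>0. \<forall>i\<in>I. Q i d"
  using assms(1,2)
proof (induction I)
  case empty
  show ?case by (intro exI[of _ 1]) simp
next
  case (insert i I)
  then obtain d where "d > 0" "\<forall>i\<in>I. Q i d" by blast
  moreover obtain d' where "d' > 0" "Q i d'" using insert.prems by blast
  ultimately show ?case
    using mono by (intro exI[of _ "min d d'"]) (metis insert_iff min.cobounded1 min.cobounded2 min_less_iff_conj)
qed

text \<open>The \<open>p j\<close> join the set with values \<open>\<beta> j\<close> and slopes
  \<open>w j\<close>. The strict inequalities keep the plane of one point away from the value at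
  another whenever one of the two is new, uniformly for bounded data, so for small
  \<open>\<delta>\<close> such pairs never meet the premise of the gap condition.\<close>

lemma convex_C1_jet_extension_add_points:
  fixes E X :: "(real^'n) set" and f :: "real^'n \<Rightarrow> real" and G :: "real^'n \<Rightarrow> real^'n"
    and p w :: "'j \<Rightarrow> real^'n" and \<beta> :: "'j \<Rightarrow> real"
  assumes "E \<noteq> {}" and "finite J" and p_notin: "\<And>j. j \<in> J \<Longrightarrow> p j \<notin> E"
    and X: "X = span {u - v | u v. u \<in> G ` E \<union> w ` J \<and> v \<in> G ` E \<union> w ` J}"
    and pp: "\<And>i j. i \<in> J \<Longrightarrow> j \<in> J \<Longrightarrow> i \<noteq> j \<Longrightarrow> \<beta> j > \<beta> i + w i \<bullet> (p j - p i)"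
    and pE: "\<And>j R. j \<in> J \<Longrightarrow> \<exists>d>0. \<forall>z\<in>E. norm (G z) \<le> R \<longrightarrow> f z + G z \<bullet> (p j - z) \<le> \<beta> j - d"
    and Ep: "\<And>R. \<exists>d>0. \<forall>x\<in>E. norm (orth_proj X x) \<le> R \<longrightarrow> (\<forall>j\<in>J. \<beta> j + w j \<bullet> (x - p j) \<le> f x - d)"
    and conv: "\<And>x y. x \<in> E \<Longrightarrow> y \<in> E \<Longrightarrow> f x \<ge> f y + G y \<bullet> (x - y)"
    and superlin: "\<And>R. \<exists>M. \<forall>z\<in>E. norm (G z) \<ge> M \<longrightarrow> G z \<bullet> z - f z \<ge> R * norm (G z)"
    and gap: "\<And>R \<epsilon>. \<epsilon> > 0 \<Longrightarrow> \<exists>\<delta>>0. \<forall>x\<in>E. \<forall>z\<in>E. norm (orth_proj X x) \<le> R \<and> norm (G z) \<le> R \<and>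
        f x - f z - G z \<bullet> (x - z) < \<delta> \<longrightarrow> norm (G x - G z) \<le> \<epsilon>"
  shows "\<exists>F. convex_on UNIV F \<and> C1_function F \<and> (\<forall>x\<in>E. F x = f x \<and> GDERIV F x :> G x) \<and>
    coercivity_subspace F = X"
proof -
  \<comment> \<open>If two of the points coincided, \<open>pp\<close> would give
    \<open>\<beta> i < \<beta> j\<close> and \<open>\<beta> j < \<beta> i\<close>.\<close>
  have inj: "inj_on p J"
  proof (rule inj_onI, rule ccontr)
    fix i j assume "i \<in> J" "j \<in> J" "p i = p j" "i \<noteq> j"
    then show False
      using pp[of i j] pp[of j i] by simp
  qed
  define f' where "f' x = (if x \<in> E then f x else \<beta> (inv_into J p x))" for x
  define G' where "G' x = (if x \<in> E then G x else w (inv_into J p x))" for x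
  have f'_E: "f' x = f x" and G'_E: "G' x = G x" if "x \<in> E" for x
    using that by (simp_all add: f'_def G'_def)
  have f'_p: "f' (p j) = \<beta> j" and G'_p: "G' (p j) = w j" if "j \<in> J" for j
    using that p_notin inj by (simp_all add: f'_def G'_def)
  note new_simps = f'_E G'_E f'_p G'_p
  have split: thesis
    if "x \<in> E \<union> p ` J" "y \<in> E \<union> p ` J" "x \<in> E \<Longrightarrow> y \<in> E \<Longrightarrow> thesis"
      "\<And>j. j \<in> J \<Longrightarrow> x = p j \<Longrightarrow> y \<in> E \<Longrightarrow> thesis" "\<And>j. x \<in> E \<Longrightarrow> j \<in> J \<Longrightarrow> y = p j \<Longrightarrow> thesis"
      "x = y \<Longrightarrow> thesis" "\<And>i j. i \<in> J \<Longrightarrow> j \<in> J \<Longrightarrow> i \<noteq> j \<Longrightarrow> x = p j \<Longrightarrow> y = p i \<Longrightarrow> thesis"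
    for x y thesis
    using that by blast
  have "\<exists>F. convex_on UNIV F \<and> C1_function F \<and> (\<forall>x\<in>E \<union> p ` J. F x = f' x \<and> GDERIV F x :> G' x) \<and>
      coercivity_subspace F = X"
  proof (rule convex_C1_jet_extension)
    show "E \<union> p ` J \<noteq> {}" using \<open>E \<noteq> {}\<close> by simp
    have "G' ` (E \<union> p ` J) = G ` E \<union> w ` J"
      by (simp add: image_Un image_image new_simps cong: image_cong)
    moreover have "{G' x - G' y |x y. x \<in> S \<and> y \<in> S} = {u - v | u v. u \<in> G' ` S \<and> v \<in> G' ` S}" for S
      by blast
    ultimately show "X = span {G' x - G' y |x y. x \<in> E \<union> p ` J \<and> y \<in> E \<union> p ` J}"
      using X by (simp only:)
  next
    fix x y assume xy: "x \<in> E \<union> p ` J" "y \<in> E \<union> p ` J"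
    show "f' x \<ge> f' y + G' y \<bullet> (x - y)"
    proof (rule split[OF xy])
      fix j assume "j \<in> J" "x = p j" "y \<in> E"
      then show ?thesis
        using pE[of j "norm (G y)"] by (force simp: new_simps)
    next
      fix j assume "x \<in> E" "j \<in> J" "y = p j"
      then show ?thesis
        using Ep[of "norm (orth_proj X x)"] by (force simp: new_simps)
    next
      fix i j assume "i \<in> J" "j \<in> J" "i \<noteq> j" "x = p j" "y = p i"
      then show ?thesis
        using pp[of i j] by (simp add: new_simps)
    qed (use conv in \<open>auto simp: new_simps\<close>)
  next
    fix R
    obtain M where M: "\<And>z. z \<in> E \<Longrightarrow> norm (G z) \<ge> M \<Longrightarrow> G z \<bullet> z - f z \<ge> R * norm (G z)"
      using superlin[of R] by blast
    \<comment> \<open>Beyond this threshold only slopes at points of \<open>E\<close> occur.\<close>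
    define M' where "M' = max M ((\<Sum>j\<in>J. norm (w j)) + 1)"
    have "G' z \<bullet> z - f' z \<ge> R * norm (G' z)" if z: "z \<in> E \<union> p ` J" "norm (G' z) \<ge> M'" for z
    proof (cases "z \<in> E")
      case True
      then show ?thesis
        using z M[of z] by (simp add: new_simps M'_def)
    next
      case False
      then obtain j where j: "j \<in> J" "z = p j" using z(1) by blast
      then have "norm (G' z) \<le> (\<Sum>j\<in>J. norm (w j))"
        using \<open>finite J\<close> member_le_sum[of j J "\<lambda>j. norm (w j)"] by (simp add: new_simps)
      then show ?thesis
        using z(2) by (simp add: M'_def)
    qed
    then show "\<exists>M. \<forall>z\<in>E \<union> p ` J. norm (G' z) \<ge> M \<longrightarrow> G' z \<bullet> z - f' z \<ge> R * norm (G' z)"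
      by blast
  next
    fix R \<epsilon> :: real assume "\<epsilon> > 0"
    obtain d0 where "d0 > 0" and d0: "\<And>x z. x \<in> E \<Longrightarrow> z \<in> E \<Longrightarrow> norm (orth_proj X x) \<le> R \<Longrightarrow> norm (G z) \<le> R \<Longrightarrow>
        f x - f z - G z \<bullet> (x - z) < d0 \<Longrightarrow> norm (G x - G z) \<le> \<epsilon>"
      using gap[OF \<open>\<epsilon> > 0\<close>, of R] by blast
    have "\<exists>d>0. \<forall>j\<in>J. \<forall>z\<in>E. norm (G z) \<le> R \<longrightarrow> f z + G z \<bullet> (p j - z) \<le> \<beta> j - d"
    proof (rule finite_uniform_pos[OF \<open>finite J\<close> pE])
      fix j d d'
      assume *: "\<forall>z\<in>E. norm (G z) \<le> R \<longrightarrow> f z + G z \<bullet> (p j - z) \<le> \<beta> j - d" "d' \<le> d"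
      show "\<forall>z\<in>E. norm (G z) \<le> R \<longrightarrow> f z + G z \<bullet> (p j - z) \<le> \<beta> j - d'"
      proof (intro ballI impI)
        fix z assume "z \<in> E" "norm (G z) \<le> R"
        then show "f z + G z \<bullet> (p j - z) \<le> \<beta> j - d'"
          using *(1)[rule_format, of z] *(2) by simp
      qed
    qed
    then obtain d1 where "d1 > 0" and d1: "\<And>j z. j \<in> J \<Longrightarrow> z \<in> E \<Longrightarrow> norm (G z) \<le> R \<Longrightarrow>
        f z + G z \<bullet> (p j - z) \<le> \<beta> j - d1"
      by blast
    obtain d2 where "d2 > 0" and d2: "\<And>x j. x \<in> E \<Longrightarrow> norm (orth_proj X x) \<le> R \<Longrightarrow> j \<in> J \<Longrightarrow>
        \<beta> j + w j \<bullet> (x - p j) \<le> f x - d2"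
      using Ep[of R] by blast
    define Q where "Q = (\<lambda>(i, j) d. i \<noteq> j \<longrightarrow> \<beta> i + w i \<bullet> (p j - p i) \<le> \<beta> j - d)"
    have "\<exists>d>0. \<forall>ij\<in>J \<times> J. Q ij d"
    proof (rule finite_uniform_pos)
      fix ij assume "ij \<in> J \<times> J"
      then show "\<exists>d>0. Q ij d"
        using pp[of "fst ij" "snd ij"]
        by (intro exI[of _ "if fst ij = snd ij then 1 else
              \<beta> (snd ij) - (\<beta> (fst ij) + w (fst ij) \<bullet> (p (snd ij) - p (fst ij)))"])
          (auto simp: Q_def)
    qed (use \<open>finite J\<close> in \<open>auto simp: Q_def\<close>)
    then obtain d3 where "d3 > 0" and Q3: "\<forall>ij\<in>J \<times> J. Q ij d3" by blast
    have d3: "\<beta> i + w i \<bullet> (p j - p i) \<le> \<beta> j - d3" if "i \<in> J" "j \<in> J" "i \<noteq> j" for i j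
      using Q3[rule_format, of "(i, j)"] that by (simp add: Q_def)
    define \<delta> where "\<delta> = min (min d0 d1) (min d2 d3)"
    have "norm (G' x - G' z) \<le> \<epsilon>"
      if xz: "x \<in> E \<union> p ` J" "z \<in> E \<union> p ` J" and "norm (orth_proj X x) \<le> R" "norm (G' z) \<le> R"
        and gap: "f' x - f' z - G' z \<bullet> (x - z) < \<delta>" for x z
    proof (rule split[OF xz])
      assume "x \<in> E" "z \<in> E"
      then show ?thesis
        using that d0[of x z] by (simp add: new_simps \<delta>_def)
    next
      fix j assume "j \<in> J" "x = p j" "z \<in> E"
      then show ?thesis
        using that d1[of j z] by (simp add: new_simps \<delta>_def)
    next
      fix j assume "x \<in> E" "j \<in> J" "z = p j"
      then show ?thesis
        using that d2[of x j] by (simp add: new_simps \<delta>_def)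
    next
      fix i j assume "i \<in> J" "j \<in> J" "i \<noteq> j" "x = p j" "z = p i"
      then show ?thesis
        using that d3[of i j] by (simp add: new_simps \<delta>_def)
    qed (use \<open>\<epsilon> > 0\<close> in simp)
    moreover have "\<delta> > 0"
      using \<open>d0 > 0\<close> \<open>d1 > 0\<close> \<open>d2 > 0\<close> \<open>d3 > 0\<close> by (simp add: \<delta>_def)
    ultimately show "\<exists>\<delta>>0. \<forall>x\<in>E \<union> p ` J. \<forall>z\<in>E \<union> p ` J. norm (orth_proj X x) \<le> R \<and> norm (G' z) \<le> R \<and>
        f' x - f' z - G' z \<bullet> (x - z) < \<delta> \<longrightarrow> norm (G' x - G' z) \<le> \<epsilon>"
      by blast
  qed
  then show ?thesis
    using new_simps(1,2) by (metis UnI1)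
qed

section \<open>From sequential conditions to uniform ones\<close>

lemma superlinear_of_sequences:
  fixes G :: "'a::real_inner \<Rightarrow> 'a"
  assumes seq: "\<And>x::nat \<Rightarrow> 'a. (\<And>k. x k \<in> E) \<Longrightarrow> filterlim (\<lambda>k. norm (G (x k))) at_top sequentially \<Longrightarrow>
      filterlim (\<lambda>k. (G (x k) \<bullet> x k - f (x k)) / norm (G (x k))) at_top sequentially"
  shows "\<exists>M. \<forall>z\<in>E. norm (G z) \<ge> M \<longrightarrow> G z \<bullet> z - f z \<ge> R * norm (G z)"
proof (rule ccontr)
  assume "\<not> ?thesis"
  \<comment> \<open>The summand 1 keeps the slopes nonzero, so that the quotient can be
    cleared.\<close>
  then have "\<exists>z. z \<in> E \<and> norm (G z) \<ge> real k + 1 \<and> G z \<bullet> z - f z < R * norm (G z)" for k :: nat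
    by (auto simp: not_le)
  then obtain x where x: "\<And>k. x k \<in> E" "\<And>k. norm (G (x k)) \<ge> real k + 1"
      "\<And>k. G (x k) \<bullet> x k - f (x k) < R * norm (G (x k))"
    by metis
  have "filterlim (\<lambda>k. norm (G (x k))) at_top sequentially"
  proof (rule filterlim_at_top_mono[OF filterlim_real_sequentially])
    show "\<forall>\<^sub>F k in sequentially. real k \<le> norm (G (x k))"
      using x(2) by (intro always_eventually allI) (smt (verit))
  qed
  from seq[OF x(1) this] have "\<forall>\<^sub>F k in sequentially. R \<le> (G (x k) \<bullet> x k - f (x k)) / norm (G (x k))"
    unfolding filterlim_at_top by blast
  then obtain k where k: "R \<le> (G (x k) \<bullet> x k - f (x k)) / norm (G (x k))"
    unfolding eventually_sequentially by blast
  have "norm (G (x k)) > 0"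
    using x(2)[of k] by (smt (verit) of_nat_0_le_iff)
  then show False
    using k x(3)[of k] by (simp add: pos_le_divide_eq)
qed

text \<open>Violating pairs for \<open>\<delta> = 1 / (k + 1)\<close> form sequences whose gaps are
  squeezed to 0, nonnegativity coming from \<open>conv\<close>, while their slopes stay
  \<open>\<epsilon>\<close> apart.\<close>

lemma gap_of_sequences:
  fixes G :: "'a::real_inner \<Rightarrow> 'a" and P :: "'a \<Rightarrow> 'b::real_normed_vector"
  assumes conv: "\<And>x y. x \<in> E \<Longrightarrow> y \<in> E \<Longrightarrow> f x \<ge> f y + G y \<bullet> (x - y)"
    and seq: "\<And>x z::nat \<Rightarrow> 'a. (\<And>k. x k \<in> E) \<Longrightarrow> (\<And>k. z k \<in> E) \<Longrightarrow>
      bounded (range (\<lambda>k. P (x k))) \<Longrightarrow> bounded (range (\<lambda>k. G (z k))) \<Longrightarrow>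
      (\<lambda>k. f (x k) - f (z k) - G (z k) \<bullet> (x k - z k)) \<longlonglongrightarrow> 0 \<Longrightarrow> (\<lambda>k. norm (G (x k) - G (z k))) \<longlonglongrightarrow> 0"
    and "\<epsilon> > 0"
  shows "\<exists>\<delta>>0. \<forall>x\<in>E. \<forall>z\<in>E. norm (P x) \<le> R \<and> norm (G z) \<le> R \<and>
        f x - f z - G z \<bullet> (x - z) < \<delta> \<longrightarrow> norm (G x - G z) \<le> \<epsilon>"
proof (rule ccontr)
  assume not: "\<not> ?thesis"
  have "\<exists>x z. x \<in> E \<and> z \<in> E \<and> norm (P x) \<le> R \<and> norm (G z) \<le> R \<and>
      f x - f z - G z \<bullet> (x - z) < inverse (real (Suc k)) \<and> norm (G x - G z) > \<epsilon>" for k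
    using not[unfolded not_ex, rule_format, of "inverse (real (Suc k))"] by (auto simp: not_le)
  then obtain x z where xz: "\<And>k. x k \<in> E" "\<And>k. z k \<in> E" "\<And>k. norm (P (x k)) \<le> R" "\<And>k. norm (G (z k)) \<le> R"
      "\<And>k. f (x k) - f (z k) - G (z k) \<bullet> (x k - z k) < inverse (real (Suc k))"
      "\<And>k. norm (G (x k) - G (z k)) > \<epsilon>"
    by metis
  have "(\<lambda>k. f (x k) - f (z k) - G (z k) \<bullet> (x k - z k)) \<longlonglongrightarrow> 0"
  proof (rule tendsto_sandwich[OF _ _ tendsto_const LIMSEQ_inverse_real_of_nat])
    show "\<forall>\<^sub>F k in sequentially. 0 \<le> f (x k) - f (z k) - G (z k) \<bullet> (x k - z k)"
      using conv xz(1,2) by (intro always_eventually allI) (simp add: algebra_simps)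
    show "\<forall>\<^sub>F k in sequentially. f (x k) - f (z k) - G (z k) \<bullet> (x k - z k) \<le> inverse (real (Suc k))"
      using xz(5) by (intro always_eventually allI less_imp_le)
  qed
  moreover have "bounded (range (\<lambda>k. P (x k)))" "bounded (range (\<lambda>k. G (z k)))"
    using xz(3,4) by (auto simp: bounded_iff)
  ultimately have "(\<lambda>k. norm (G (x k) - G (z k))) \<longlonglongrightarrow> 0"
    using xz(1,2) by (intro seq)
  then have "\<forall>\<^sub>F k in sequentially. norm (G (x k) - G (z k)) < \<epsilon>"
    using \<open>\<epsilon> > 0\<close> by (rule order_tendstoD)
  then obtain k where "norm (G (x k) - G (z k)) < \<epsilon>"
    unfolding eventually_sequentially by blast
  then show False
    using xz(6)[of k] by simp
qed

section \<open>Properties of the gradients of a given convex function\<close>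

text \<open>\<open>D y \<bullet> y - F y\<close> is the convex conjugate of \<open>F\<close> at
  \<open>D y\<close>. Testing the tangent plane at the point \<open>u\<close> of norm
  \<open>R\<close> in the direction of \<open>D y\<close> bounds it below by
  \<open>R * norm (D y) - F u\<close>, and \<open>F\<close> is bounded on the ball.\<close>

lemma convex_gradient_superlinear:
  fixes F :: "'a::euclidean_space \<Rightarrow> real"
  assumes conv: "convex_on UNIV F" and D: "\<And>x. GDERIV F x :> D x"
    and lim: "filterlim (\<lambda>k. norm (D (x k))) at_top sequentially"
  shows "filterlim (\<lambda>k. (D (x k) \<bullet> x k - F (x k)) / norm (D (x k))) at_top sequentially"
  unfolding filterlim_at_top
proof
  fix Z :: real
  define R where "R = \<bar>Z\<bar> + 1"
  have "continuous_on (cball 0 R) F"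
    using convex_on_continuous[OF open_UNIV conv] by (rule continuous_on_subset) simp
  then have "bounded (F ` cball 0 R)"
    by (intro compact_imp_bounded compact_continuous_image) auto
  then obtain K where "\<forall>t\<in>F ` cball 0 R. norm t \<le> K"
    unfolding bounded_iff by blast
  then have K: "\<bar>F y\<bar> \<le> K" if "norm y \<le> R" for y
    using that by simp
  have "Z \<le> (D y \<bullet> y - F y) / norm (D y)" if y: "norm (D y) \<ge> max 1 K" for y
  proof -
    have "norm (D y) \<ge> 1" using y by simp
    then have "norm (D y) > 0" by linarith
    define u where "u = R *\<^sub>R sgn (D y)"
    have "norm u \<le> R"
      using \<open>norm (D y) > 0\<close> by (simp add: u_def R_def norm_sgn)
    have "D y \<bullet> u = R * norm (D y)"
      using \<open>norm (D y) > 0\<close> by (simp add: u_def sgn_div_norm dot_square_norm power2_eq_square)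
    then have "D y \<bullet> y - F y \<ge> R * norm (D y) - F u"
      using convex_on_GDERIV_ge[OF conv D[of y], of u] by (simp add: inner_diff_right)
    moreover have "F u \<le> norm (D y)"
      using K[OF \<open>norm u \<le> R\<close>] y by auto
    moreover have "R * norm (D y) = \<bar>Z\<bar> * norm (D y) + norm (D y)"
      by (simp add: R_def distrib_right)
    moreover have "Z * norm (D y) \<le> \<bar>Z\<bar> * norm (D y)"
      by (intro mult_right_mono) auto
    ultimately show ?thesis
      unfolding pos_le_divide_eq[OF \<open>norm (D y) > 0\<close>] by linarith
  qed
  moreover have "\<forall>\<^sub>F k in sequentially. max 1 K \<le> norm (D (x k))"
    using lim unfolding filterlim_at_top by blast
  ultimately show "\<forall>\<^sub>F k in sequentially. Z \<le> (D (x k) \<bullet> x k - F (x k)) / norm (D (x k))"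
    by (auto elim: eventually_mono)
qed

text \<open>Supplies the missing slopes: a basis of \<open>Y\<close> is extended to one of
  \<open>X\<close> by differences \<open>D x - D x0\<close>, and \<open>p\<close> enumerates points
  that realise them. By independence the added vectors lie outside \<open>Y\<close> and are
  distinct.\<close>

lemma complementary_differences:
  fixes D :: "'b \<Rightarrow> 'a::euclidean_space"
  assumes X: "X = span {D x - D y | x y. True}" and "subspace Y" and "Y \<subseteq> X"
  shows "\<exists>p::nat \<Rightarrow> 'b. (\<forall>j\<in>{1..dim X - dim Y}. D (p j) - D x0 \<notin> Y) \<and>
    inj_on (\<lambda>j. D (p j)) {1..dim X - dim Y} \<and>
    X \<subseteq> span (Y \<union> (\<lambda>j. D (p j) - D x0) ` {1..dim X - dim Y})"
proof -
  let ?A = "range (\<lambda>x. D x - D x0)"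
  have X_A: "X = span ?A"
  proof
    show "X \<subseteq> span ?A"
      unfolding X
    proof (rule span_minimal)
      show "{D x - D y |x y. True} \<subseteq> span ?A"
      proof clarify
        fix x y
        have "(D x - D x0) - (D y - D x0) \<in> span ?A"
          by (intro span_diff span_base) auto
        then show "D x - D y \<in> span ?A" by simp
      qed
    qed simp
    show "span ?A \<subseteq> X"
      unfolding X by (rule span_mono) blast
  qed
  obtain B0 where B0: "B0 \<subseteq> Y" "independent B0" "Y \<subseteq> span B0" "card B0 = dim Y"
    using basis_exists[of Y] by blast
  have "span B0 = Y"
    using B0 \<open>subspace Y\<close> by (metis span_subspace)
  obtain B where B: "B0 \<subseteq> B" "B \<subseteq> B0 \<union> ?A" "independent B" "B0 \<union> ?A \<subseteq> span B"
    using maximal_independent_subset_extend[of B0 "B0 \<union> ?A"] B0(2) by blast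
  have "?A \<subseteq> X"
    unfolding X_A by (rule span_superset)
  then have "B \<subseteq> X"
    using B(2) B0(1) \<open>Y \<subseteq> X\<close> by blast
  have X_B: "X \<subseteq> span B"
    unfolding X_A using B(4) by (intro span_minimal) auto
  have "span B = X"
    using \<open>B \<subseteq> X\<close> X_B X by (metis span_subspace subspace_span)
  have "dim X = card B"
    by (rule dim_unique[OF \<open>B \<subseteq> X\<close> X_B B(3) refl])
  have "finite B" using B(3) by (rule independent_imp_finite)
  then have card: "card (B - B0) = dim X - dim Y"
    using B(1) B0(4) \<open>dim X = card B\<close> by (simp add: card_Diff_subset finite_subset)
  obtain h where h: "bij_betw h {1..dim X - dim Y} (B - B0)"
    using ex_bij_betw_nat_finite_1[of "B - B0"] \<open>finite B\<close> card by auto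
  have h_in: "h j \<in> B - B0" if "j \<in> {1..dim X - dim Y}" for j
    using h that by (auto simp: bij_betw_def)
  then have "\<forall>j\<in>{1..dim X - dim Y}. \<exists>x. h j = D x - D x0"
    using B(2) by blast
  then obtain p where p: "\<And>j. j \<in> {1..dim X - dim Y} \<Longrightarrow> h j = D (p j) - D x0"
    by metis
  have "D (p j) - D x0 \<notin> Y" if j: "j \<in> {1..dim X - dim Y}" for j
  proof
    assume "D (p j) - D x0 \<in> Y"
    then have "h j \<in> span B0"
      using \<open>span B0 = Y\<close> p[OF j] by simp
    also have "\<dots> \<subseteq> span (B - {h j})"
      using B(1) h_in[OF j] by (intro span_mono) auto
    finally show False
      using B(3) h_in[OF j] unfolding dependent_def by blast
  qed
  moreover have "inj_on (\<lambda>j. D (p j)) {1..dim X - dim Y}"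
  proof (rule inj_onI)
    fix i j assume ij: "i \<in> {1..dim X - dim Y}" "j \<in> {1..dim X - dim Y}" "D (p i) = D (p j)"
    then have "h i = h j" using p by simp
    then show "i = j"
      using h ij(1,2) by (auto simp: bij_betw_def dest: inj_onD)
  qed
  moreover have "X \<subseteq> span (Y \<union> (\<lambda>j. D (p j) - D x0) ` {1..dim X - dim Y})"
  proof -
    have "B - B0 = h ` {1..dim X - dim Y}"
      using h by (simp add: bij_betw_def)
    also have "\<dots> = (\<lambda>j. D (p j) - D x0) ` {1..dim X - dim Y}"
      using p by (intro image_cong) auto
    finally have "B \<subseteq> Y \<union> (\<lambda>j. D (p j) - D x0) ` {1..dim X - dim Y}"
      using B0(1) by blast
    then show ?thesis
      using \<open>span B = X\<close> span_mono by blast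
  qed
  ultimately show ?thesis by blast
qed

text \<open>A real number strictly between the supremum and \<open>b\<close> gives the margin. For
  empty \<open>A\<close> the supremum is minus infinity, which the same argument covers.\<close>

lemma SUP_ereal_less_obtain_gap:
  assumes "(SUP x\<in>A. ereal (g x)) < ereal b"
  shows "\<exists>d>0. \<forall>x\<in>A. g x \<le> b - d"
proof -
  obtain r where r: "(SUP x\<in>A. ereal (g x)) < ereal r" "ereal r < ereal b"
    using ereal_dense2[OF assms] by blast
  have "g x \<le> r" if "x \<in> A" for x
  proof -
    have "ereal (g x) \<le> (SUP x\<in>A. ereal (g x))"
      using that by (rule SUP_upper)
    also have "\<dots> < ereal r" by (rule r(1))
    finally show ?thesis by simp
  qed
  then show ?thesis
    using r(2) by (intro exI[of _ "b - r"]) auto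
qed

lemma SUP_ereal_less_gap:
  assumes "d > 0" and "\<And>x. x \<in> A \<Longrightarrow> g x \<le> b - d"
  shows "(SUP x\<in>A. ereal (g x)) < ereal b"
proof -
  have "(SUP x\<in>A. ereal (g x)) \<le> ereal (b - d)"
    using assms(2) by (intro SUP_least) simp
  also have "\<dots> < ereal b" using assms(1) by simp
  finally show ?thesis .
qed

lemma gradients_sequential_gap:
  fixes D :: "real^'n \<Rightarrow> real^'n"
  assumes conv: "convex_on UNIV F" and D: "\<And>x. GDERIV F x :> D x"
    and X: "subspace X" "\<And>x y. D x - D y \<in> X"
    and bdd: "bounded (range (\<lambda>k. orth_proj X (x k)))"
    and lim: "(\<lambda>k. F (x k) - F (z k) - D (z k) \<bullet> (x k - z k)) \<longlonglongrightarrow> 0"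
  shows "(\<lambda>k. norm (D (x k) - D (z k))) \<longlonglongrightarrow> 0"
proof (rule tendstoI)
  fix \<epsilon> :: real assume "\<epsilon> > 0"
  obtain R where R: "\<And>k. norm (orth_proj X (x k)) \<le> R"
    using bdd unfolding bounded_iff by blast
  obtain \<delta> where "\<delta> > 0" and \<delta>: "\<And>x z. norm (orth_proj X x) \<le> R \<Longrightarrow>
      F x - F z - D z \<bullet> (x - z) < \<delta> \<Longrightarrow> norm (D x - D z) < \<epsilon>"
    using convex_gradient_gap[OF conv D X \<open>\<epsilon> > 0\<close>, of R] by blast
  have "\<forall>\<^sub>F k in sequentially. F (x k) - F (z k) - D (z k) \<bullet> (x k - z k) < \<delta>"
    using lim \<open>\<delta> > 0\<close> by (rule order_tendstoD)
  then show "\<forall>\<^sub>F k in sequentially. dist (norm (D (x k) - D (z k))) 0 < \<epsilon>"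
    by (rule eventually_mono) (use \<delta>[OF R] in simp)
qed

text \<open>For empty \<open>E\<close> and \<open>X \<noteq> {0}\<close> the equivalence fails:
  differences of \<open>dim X\<close> vectors span at most \<open>dim X - 1\<close> dimensions, so
  the span condition cannot hold, while the squared norm of the projection onto \<open>X\<close> is
  a C1 convex function with subspace \<open>X\<close>. The natural-number subtraction in
  \<open>m\<close> is exact as soon as \<open>Y \<subseteq> X\<close>. Values in
  \<open>ereal\<close> give empty suprema and infima their infinite values.\<close>

theorem theorem1p13:
  fixes E X :: "(real^'n) set" and f :: "real^'n \<Rightarrow> real" and G :: "real^'n \<Rightarrow> real^'n"
  assumes "subspace X" and "E \<noteq> {} \<or> X = {0}"
  shows
    "(\<exists>F. convex_on UNIV F \<and> C1_function F \<and>
          (\<forall>x\<in>E. F x = f x \<and> GDERIV F x :> G x) \<and> coercivity_subspace F = X)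
     \<longleftrightarrow>
     (let P = orth_proj X;
          Y = span {G x - G y | x y. x \<in> E \<and> y \<in> E};
          m = dim X - dim Y
      in
       (continuous_on E G \<and> (\<forall>x\<in>E. \<forall>y\<in>E. f x \<ge> f y + G y \<bullet> (x - y))) \<and>
       (\<forall>x::nat \<Rightarrow> real^'n. (\<forall>k. x k \<in> E) \<and>
            filterlim (\<lambda>k. norm (G (x k))) at_top sequentially \<longrightarrow>
            filterlim (\<lambda>k. (G (x k) \<bullet> x k - f (x k)) / norm (G (x k))) at_top sequentially) \<and>
       Y \<subseteq> X \<and>
       (Y \<noteq> X \<longrightarrow>
          (\<exists>(p::nat \<Rightarrow> real^'n) (\<beta>::nat \<Rightarrow> real) (w::nat \<Rightarrow> real^'n).
             (\<forall>j\<in>{1..m}. p j \<notin> closure E) \<and>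
             X = span {u - v | u v. u \<in> G ` E \<union> w ` {1..m} \<and> v \<in> G ` E \<union> w ` {1..m}} \<and>
             (\<forall>j\<in>{1..m}.
                ereal (\<beta> j) > (SUP i\<in>{1..m} - {j}. ereal (\<beta> i + w i \<bullet> (p j - p i)))) \<and>
             (\<forall>j\<in>{1..m}. \<forall>N::nat.
                ereal (\<beta> j) >
                  (SUP z\<in>{z\<in>E. norm (G z) \<le> real N}. ereal (f z + G z \<bullet> (p j - z)))) \<and>
             (\<forall>N::nat.
                (INF x\<in>{x\<in>E. norm (P x) \<le> real N}.
                   ereal (f x) - (SUP j\<in>{1..m}. ereal (\<beta> j + w j \<bullet> (x - p j)))) > 0))) \<and>
       (\<forall>x z :: nat \<Rightarrow> real^'n.
          (\<forall>k. x k \<in> E) \<and> (\<forall>k. z k \<in> E) \<and>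
          bounded (range (\<lambda>k. P (x k))) \<and> bounded (range (\<lambda>k. G (z k))) \<and>
          (\<lambda>k. f (x k) - f (z k) - G (z k) \<bullet> (x k - z k)) \<longlonglongrightarrow> 0 \<longrightarrow>
          (\<lambda>k. norm (G (x k) - G (z k))) \<longlonglongrightarrow> 0))"
proof (cases "E = {}")
  case True
  \<comment> \<open>The zero function has the trivial subspace, and the conditions on the right hold
    trivially since \<open>Y = X = {0}\<close>.\<close>
  then have X0: "X = {0}" using assms(2) by simp
  have "coercivity_subspace (\<lambda>_::real^'n. 0 :: real) = X"
    using coercivity_subspace_eq_span[of "\<lambda>_::real^'n. 0" "\<lambda>_. 0"]
    by (simp add: X0 convex_on_const GDERIV_const)
  moreover have "C1_function (\<lambda>_::real^'n. 0 :: real)"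
    unfolding C1_function_def using GDERIV_const by (intro exI[of _ "\<lambda>_. 0"]) auto
  moreover have "convex_on UNIV (\<lambda>_::real^'n. 0 :: real)"
    by (simp add: convex_on_const)
  ultimately have L: "\<exists>F. convex_on UNIV F \<and> C1_function F \<and>
      (\<forall>x\<in>E. F x = f x \<and> GDERIV F x :> G x) \<and> coercivity_subspace F = X"
    using True by blast
  show ?thesis
    by (rule iffI, simp add: True X0 Let_def, rule L)
next
  case False
  then obtain x0 where x0: "x0 \<in> E" by blast
  define Y where "Y = span {G x - G y | x y. x \<in> E \<and> y \<in> E}"
  define m where "m = dim X - dim Y"
  show ?thesis
    unfolding Let_def Y_def[symmetric] m_def[symmetric]
  proof (rule iffI, goal_cases)

    \<comment> \<open>Necessity: reading the conditions off a given extension\<close>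
    case 1
    then obtain F D where conv: "convex_on UNIV F" and D: "\<And>x. GDERIV F x :> D x"
      and D_cont: "continuous_on UNIV D" and F_f: "\<And>x. x \<in> E \<Longrightarrow> F x = f x"
      and F_G: "\<And>x. x \<in> E \<Longrightarrow> GDERIV F x :> G x" and F_X: "coercivity_subspace F = X"
      unfolding C1_function_def by blast
    have D_G: "D x = G x" if "x \<in> E" for x
      using GDERIV_unique[OF D F_G[OF that]] .
    have X: "X = span {D x - D y | x y. True}"
      using coercivity_subspace_eq_span[OF conv D] F_X by simp
    have D_X: "D x - D y \<in> X" for x y
      unfolding X by (intro span_base) blast
    note gap = convex_gradient_gap[OF conv D assms(1) D_X]
    have Y_X: "Y \<subseteq> X"
      unfolding Y_def using D_X D_G assms(1) by (intro span_minimal) (auto, metis)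
    have "subspace Y" by (simp add: Y_def)
    have G_Y: "G x - G y \<in> Y" if "x \<in> E" "y \<in> E" for x y
      unfolding Y_def using that by (intro span_base) blast
    have 11: "continuous_on E G"
      using continuous_on_subset[OF D_cont, of E] D_G by (simp cong: continuous_on_cong)
    have 12: "\<forall>x\<in>E. \<forall>y\<in>E. f x \<ge> f y + G y \<bullet> (x - y)"
      using convex_on_GDERIV_ge[OF conv F_G] F_f by metis
    have 13: "\<forall>x::nat \<Rightarrow> real^'n. (\<forall>k. x k \<in> E) \<and>
            filterlim (\<lambda>k. norm (G (x k))) at_top sequentially \<longrightarrow>
            filterlim (\<lambda>k. (G (x k) \<bullet> x k - f (x k)) / norm (G (x k))) at_top sequentially"
    proof (intro allI impI, elim conjE)
      fix x :: "nat \<Rightarrow> real^'n" assume x: "\<forall>k. x k \<in> E"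
      assume "filterlim (\<lambda>k. norm (G (x k))) at_top sequentially"
      then have "filterlim (\<lambda>k. norm (D (x k))) at_top sequentially"
        using x D_G by simp
      from convex_gradient_superlinear[OF conv D this]
      show "filterlim (\<lambda>k. (G (x k) \<bullet> x k - f (x k)) / norm (G (x k))) at_top sequentially"
        using x D_G F_f by simp
    qed
    have 15: "\<forall>x z :: nat \<Rightarrow> real^'n.
          (\<forall>k. x k \<in> E) \<and> (\<forall>k. z k \<in> E) \<and>
          bounded (range (\<lambda>k. orth_proj X (x k))) \<and> bounded (range (\<lambda>k. G (z k))) \<and>
          (\<lambda>k. f (x k) - f (z k) - G (z k) \<bullet> (x k - z k)) \<longlonglongrightarrow> 0 \<longrightarrow>
          (\<lambda>k. norm (G (x k) - G (z k))) \<longlonglongrightarrow> 0"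
    proof (intro allI impI, elim conjE)
      fix x z :: "nat \<Rightarrow> real^'n"
      assume xz: "\<forall>k. x k \<in> E" "\<forall>k. z k \<in> E" and bdd: "bounded (range (\<lambda>k. orth_proj X (x k)))"
        and lim: "(\<lambda>k. f (x k) - f (z k) - G (z k) \<bullet> (x k - z k)) \<longlonglongrightarrow> 0"
      have "(\<lambda>k. F (x k) - F (z k) - D (z k) \<bullet> (x k - z k)) \<longlonglongrightarrow> 0"
        using lim xz D_G F_f by simp
      from gradients_sequential_gap[OF conv D assms(1) D_X bdd this]
      show "(\<lambda>k. norm (G (x k) - G (z k))) \<longlonglongrightarrow> 0"
        using xz D_G by simp
    qed
    have 14: "\<exists>(p::nat \<Rightarrow> real^'n) (\<beta>::nat \<Rightarrow> real) (w::nat \<Rightarrow> real^'n).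
             (\<forall>j\<in>{1..m}. p j \<notin> closure E) \<and>
             X = span {u - v | u v. u \<in> G ` E \<union> w ` {1..m} \<and> v \<in> G ` E \<union> w ` {1..m}} \<and>
             (\<forall>j\<in>{1..m}.
                ereal (\<beta> j) > (SUP i\<in>{1..m} - {j}. ereal (\<beta> i + w i \<bullet> (p j - p i)))) \<and>
             (\<forall>j\<in>{1..m}. \<forall>N::nat.
                ereal (\<beta> j) >
                  (SUP z\<in>{z\<in>E. norm (G z) \<le> real N}. ereal (f z + G z \<bullet> (p j - z)))) \<and>
             (\<forall>N::nat.
                (INF x\<in>{x\<in>E. norm (orth_proj X x) \<le> real N}.
                   ereal (f x) - (SUP j\<in>{1..m}. ereal (\<beta> j + w j \<bullet> (x - p j)))) > 0)"
    proof -
      obtain p where p: "\<And>j. j \<in> {1..m} \<Longrightarrow> D (p j) - D x0 \<notin> Y"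
        and inj: "inj_on (\<lambda>j. D (p j)) {1..m}"
        and span: "X \<subseteq> span (Y \<union> (\<lambda>j. D (p j) - D x0) ` {1..m})"
        using complementary_differences[OF X \<open>subspace Y\<close> Y_X, of x0] unfolding m_def by blast
      define w where "w j = D (p j)" for j
      define \<beta> where "\<beta> j = F (p j)" for j
      have "closed Y" using \<open>subspace Y\<close> by (rule closed_subspace)
      \<comment> \<open>The points at which \<open>D - D x0\<close> takes values in \<open>Y\<close>
        form a closed set containing \<open>E\<close>, and \<open>p j\<close> is not among
        them.\<close>
      have a: "p j \<notin> closure E" if "j \<in> {1..m}" for j
      proof
        assume "p j \<in> closure E"
        moreover have "closed ((\<lambda>x. D x - D x0) -` Y)"
          using \<open>closed Y\<close> D_cont
          by (intro continuous_closed_vimage continuous_intros)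
            (auto simp: continuous_on_eq_continuous_at)
        moreover have "E \<subseteq> (\<lambda>x. D x - D x0) -` Y"
          using G_Y x0 D_G by auto
        ultimately have "D (p j) - D x0 \<in> Y"
          using closure_minimal by blast
        then show False using p[OF that] by simp
      qed
      have b: "X = span {u - v | u v. u \<in> G ` E \<union> w ` {1..m} \<and> v \<in> G ` E \<union> w ` {1..m}}" (is "X = span ?S")
      proof
        have range: "G ` E \<union> w ` {1..m} \<subseteq> range D"
        proof
          fix u assume "u \<in> G ` E \<union> w ` {1..m}"
          then show "u \<in> range D"
          proof (elim UnE imageE)
            fix x assume "u = G x" "x \<in> E"
            then have "u = D x" by (simp add: D_G)
            then show ?thesis by (rule range_eqI)
          qed (simp add: w_def)
        qed
        have "u - v \<in> X" if "u \<in> range D" "v \<in> range D" for u v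
          using that D_X by blast
        then have "?S \<subseteq> X" using range by blast
        then show "span ?S \<subseteq> X"
          using assms(1) by (rule span_minimal)
        have "Y \<subseteq> span ?S"
          unfolding Y_def by (rule span_mono) blast
        moreover have "(\<lambda>j. D (p j) - D x0) ` {1..m} \<subseteq> span ?S"
        proof (intro image_subsetI span_base CollectI exI conjI)
          fix j assume "j \<in> {1..m}"
          show "D (p j) - D x0 = w j - G x0"
            by (simp add: w_def D_G[OF x0])
          show "w j \<in> G ` E \<union> w ` {1..m}" "G x0 \<in> G ` E \<union> w ` {1..m}"
            using \<open>j \<in> {1..m}\<close> x0 by auto
        qed
        ultimately have "span (Y \<union> (\<lambda>j. D (p j) - D x0) ` {1..m}) \<subseteq> span ?S"
          by (intro span_minimal) auto
        then show "X \<subseteq> span ?S" using span by blast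
      qed
      \<comment> \<open>For \<open>x \<in> E\<close> the vector \<open>D x - D x0\<close> lies in
        the closed subspace \<open>Y\<close>, while \<open>w j - D x0\<close> does not, so the new
        slopes keep a positive distance \<open>e\<close> from all slopes on
        \<open>E\<close>.\<close>
      have "\<exists>e>0. \<forall>j\<in>{1..m}. \<forall>x\<in>E. e \<le> norm (D x - w j)"
      proof (rule finite_uniform_pos)
        fix j assume j: "j \<in> {1..m}"
        obtain e where "e > 0" and e: "\<And>y. y \<in> Y \<Longrightarrow> e \<le> dist (w j - D x0) y"
          using separate_point_closed[OF \<open>closed Y\<close> p[OF j]] unfolding w_def by blast
        have "e \<le> norm (D x - w j)" if "x \<in> E" for x
          using e[OF G_Y[OF that x0]] D_G[OF that] D_G[OF x0]
          by (simp add: dist_norm norm_minus_commute)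
        then show "\<exists>e>0. \<forall>x\<in>E. e \<le> norm (D x - w j)"
          using \<open>e > 0\<close> by blast
      qed (simp, force)
      then obtain e where "e > 0" and e: "\<And>j x. j \<in> {1..m} \<Longrightarrow> x \<in> E \<Longrightarrow> e \<le> norm (D x - w j)"
        by blast
      \<comment> \<open>The slopes at \<open>p i\<close> and \<open>p j\<close> differ, so the
        contrapositive of \<open>gap\<close> excludes a small gap between them.\<close>
      have c: "(SUP i\<in>{1..m} - {j}. ereal (\<beta> i + w i \<bullet> (p j - p i))) < ereal (\<beta> j)" if j: "j \<in> {1..m}" for j
      proof -
        have "\<exists>d>0. \<forall>i\<in>{1..m} - {j}. \<beta> i + w i \<bullet> (p j - p i) \<le> \<beta> j - d"
        proof (rule finite_uniform_pos)
          fix i assume i: "i \<in> {1..m} - {j}"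
          then have "D (p j) \<noteq> D (p i)"
            using inj j by (auto dest: inj_onD)
          then have "norm (D (p j) - D (p i)) > 0" by simp
          from gap[OF this, of "norm (orth_proj X (p j))"]
          obtain d where "d > 0" "\<not> (F (p j) - F (p i) - D (p i) \<bullet> (p j - p i) < d)"
            by blast
          then show "\<exists>d>0. \<beta> i + w i \<bullet> (p j - p i) \<le> \<beta> j - d"
            by (intro exI[of _ d]) (simp add: \<beta>_def w_def)
        qed auto
        then obtain d where "d > 0" "\<forall>i\<in>{1..m} - {j}. \<beta> i + w i \<bullet> (p j - p i) \<le> \<beta> j - d"
          by blast
        then show ?thesis
          by (intro SUP_ereal_less_gap[of d]) auto
      qed
      \<comment> \<open>The contrapositive of \<open>gap\<close> with slope distance
        \<open>e\<close>, over the ball containing the projection of \<open>p j\<close>, gives one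
        margin for all \<open>z \<in> E\<close>.\<close>
      have d: "(SUP z\<in>{z\<in>E. norm (G z) \<le> real N}. ereal (f z + G z \<bullet> (p j - z))) < ereal (\<beta> j)"
        if j: "j \<in> {1..m}" for j and N :: nat
      proof -
        obtain \<delta> where "\<delta> > 0" and \<delta>: "\<And>z. F (p j) - F z - D z \<bullet> (p j - z) < \<delta> \<Longrightarrow> norm (D (p j) - D z) < e"
          using gap[OF \<open>e > 0\<close>, of "norm (orth_proj X (p j))"] by blast
        have "f z + G z \<bullet> (p j - z) \<le> \<beta> j - \<delta>" if "z \<in> E" for z
          using \<delta>[of z] e[OF j that] D_G[OF that] F_f[OF that]
          by (force simp: \<beta>_def w_def norm_minus_commute)
        then show ?thesis
          using \<open>\<delta> > 0\<close> by (intro SUP_ereal_less_gap[of \<delta>]) auto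
      qed
      have "(INF x\<in>{x\<in>E. norm (orth_proj X x) \<le> real N}.
          ereal (f x) - (SUP j\<in>{1..m}. ereal (\<beta> j + w j \<bullet> (x - p j)))) > 0" for N :: nat
      proof -
        obtain \<delta> where "\<delta> > 0" and \<delta>: "\<And>x z. norm (orth_proj X x) \<le> real N \<Longrightarrow>
            F x - F z - D z \<bullet> (x - z) < \<delta> \<Longrightarrow> norm (D x - D z) < e"
          using gap[OF \<open>e > 0\<close>, of "real N"] by blast
        have "ereal \<delta> \<le> ereal (f x) - (SUP j\<in>{1..m}. ereal (\<beta> j + w j \<bullet> (x - p j)))"
          if x: "x \<in> E" "norm (orth_proj X x) \<le> real N" for x
        proof -
          have "\<beta> j + w j \<bullet> (x - p j) \<le> f x - \<delta>" if "j \<in> {1..m}" for j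
            using \<delta>[OF x(2), of "p j"] e[OF that x(1)] F_f[OF x(1)]
            by (force simp: \<beta>_def w_def)
          then have "(SUP j\<in>{1..m}. ereal (\<beta> j + w j \<bullet> (x - p j))) \<le> ereal (f x - \<delta>)"
            by (intro SUP_least) simp
          from ereal_minus_mono[OF order_refl this, of "ereal (f x)"] show ?thesis
            by simp
        qed
        then have "ereal \<delta> \<le> (INF x\<in>{x\<in>E. norm (orth_proj X x) \<le> real N}.
            ereal (f x) - (SUP j\<in>{1..m}. ereal (\<beta> j + w j \<bullet> (x - p j))))"
          by (intro INF_greatest) simp
        moreover have "0 < ereal \<delta>" using \<open>\<delta> > 0\<close> by simp
        ultimately show ?thesis by (rule less_le_trans[rotated])
      qed
      then show ?thesis
        using a b c d by (intro exI[of _ p] exI[of _ \<beta>] exI[of _ w] conjI ballI allI)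
    qed
    show ?case
      using 11 12 13 14 15 Y_X by (intro conjI impI)
  next

    \<comment> \<open>Sufficiency: building an extension from the conditions\<close>
    case 2
    have conv: "f x \<ge> f y + G y \<bullet> (x - y)" if "x \<in> E" "y \<in> E" for x y
      using 2[THEN conjunct1] that by blast
    note seq = 2[THEN conjunct2]
    have superlin: "\<exists>M. \<forall>z\<in>E. norm (G z) \<ge> M \<longrightarrow> G z \<bullet> z - f z \<ge> R * norm (G z)" for R
      by (rule superlinear_of_sequences) (use seq[THEN conjunct1] in blast)
    note seq = seq[THEN conjunct2]
    have "Y \<subseteq> X" using seq by blast
    have gap: "\<exists>\<delta>>0. \<forall>x\<in>E. \<forall>z\<in>E. norm (orth_proj X x) \<le> R \<and> norm (G z) \<le> R \<and>
        f x - f z - G z \<bullet> (x - z) < \<delta> \<longrightarrow> norm (G x - G z) \<le> \<epsilon>" if "\<epsilon> > 0" for R \<epsilon>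
      by (rule gap_of_sequences[OF conv _ that])
        (use seq[THEN conjunct2, THEN conjunct2] in blast)+
    show ?case
    proof (cases "Y = X")
      case True
      then have "X = span {G x - G y | x y. x \<in> E \<and> y \<in> E}"
        by (simp only: Y_def)
      from convex_C1_jet_extension[OF \<open>E \<noteq> {}\<close> this conv superlin gap] show ?thesis .
    next
      case False
      with seq[THEN conjunct2, THEN conjunct1] obtain p w :: "nat \<Rightarrow> real^'n" and \<beta> :: "nat \<Rightarrow> real"
        where p: "\<forall>j\<in>{1..m}. p j \<notin> closure E"
          and X: "X = span {u - v | u v. u \<in> G ` E \<union> w ` {1..m} \<and> v \<in> G ` E \<union> w ` {1..m}}"
          and pp: "\<forall>j\<in>{1..m}.
                ereal (\<beta> j) > (SUP i\<in>{1..m} - {j}. ereal (\<beta> i + w i \<bullet> (p j - p i)))"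
          and pE: "\<forall>j\<in>{1..m}. \<forall>N::nat.
                ereal (\<beta> j) >
                  (SUP z\<in>{z\<in>E. norm (G z) \<le> real N}. ereal (f z + G z \<bullet> (p j - z)))"
          and Ep: "\<forall>N::nat.
                (INF x\<in>{x\<in>E. norm (orth_proj X x) \<le> real N}.
                   ereal (f x) - (SUP j\<in>{1..m}. ereal (\<beta> j + w j \<bullet> (x - p j)))) > 0"
        by auto
      show ?thesis
      proof (rule convex_C1_jet_extension_add_points[OF \<open>E \<noteq> {}\<close> _ _ X _ _ _ conv superlin gap])
        show "p j \<notin> E" if "j \<in> {1..m}" for j
          using p that closure_subset by blast
        show "\<beta> i + w i \<bullet> (p j - p i) < \<beta> j" if i: "i \<in> {1..m}" and j: "j \<in> {1..m}" and "i \<noteq> j" for i j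
        proof -
          obtain d where "d > 0" and d: "\<forall>i\<in>{1..m} - {j}. \<beta> i + w i \<bullet> (p j - p i) \<le> \<beta> j - d"
            using SUP_ereal_less_obtain_gap[OF pp[rule_format, OF j]] by blast
          moreover have "\<beta> i + w i \<bullet> (p j - p i) \<le> \<beta> j - d"
            using i \<open>i \<noteq> j\<close> by (intro d[rule_format]) simp
          ultimately show ?thesis by simp
        qed
        show "\<exists>d>0. \<forall>z\<in>E. norm (G z) \<le> R \<longrightarrow> f z + G z \<bullet> (p j - z) \<le> \<beta> j - d"
          if j: "j \<in> {1..m}" for j R
        proof -
          \<comment> \<open>The margins are given for natural radii, so a real radius is rounded
            up.\<close>
          obtain d where "d > 0" and d: "\<forall>z\<in>{z\<in>E. norm (G z) \<le> real (nat \<lceil>R\<rceil>)}.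
              f z + G z \<bullet> (p j - z) \<le> \<beta> j - d"
            using SUP_ereal_less_obtain_gap[OF pE[rule_format, OF j, of "nat \<lceil>R\<rceil>"]] by blast
          have "f z + G z \<bullet> (p j - z) \<le> \<beta> j - d" if "z \<in> E" "norm (G z) \<le> R" for z
            using that real_nat_ceiling_ge[of R] by (intro d[rule_format]) simp
          then show ?thesis using \<open>d > 0\<close> by blast
        qed
        show "\<exists>d>0. \<forall>x\<in>E. norm (orth_proj X x) \<le> R \<longrightarrow> (\<forall>j\<in>{1..m}. \<beta> j + w j \<bullet> (x - p j) \<le> f x - d)" for R
        proof -
          obtain d where d: "0 < ereal d" "ereal d < (INF x\<in>{x\<in>E. norm (orth_proj X x) \<le> real (nat \<lceil>R\<rceil>)}.
                   ereal (f x) - (SUP j\<in>{1..m}. ereal (\<beta> j + w j \<bullet> (x - p j))))"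
            using ereal_dense2[OF Ep[rule_format, of "nat \<lceil>R\<rceil>"]] by (auto simp: zero_ereal_def)
          have "\<beta> j + w j \<bullet> (x - p j) \<le> f x - d"
            if x: "x \<in> E" "norm (orth_proj X x) \<le> R" and j: "j \<in> {1..m}" for x j
          proof -
            have "ereal d \<le> (INF x\<in>{x\<in>E. norm (orth_proj X x) \<le> real (nat \<lceil>R\<rceil>)}.
                   ereal (f x) - (SUP j\<in>{1..m}. ereal (\<beta> j + w j \<bullet> (x - p j))))"
              using d(2) by (rule less_imp_le)
            also have "\<dots> \<le> ereal (f x) - (SUP j\<in>{1..m}. ereal (\<beta> j + w j \<bullet> (x - p j)))"
              using x real_nat_ceiling_ge[of R] by (intro INF_lower) simp
            also have "\<dots> \<le> ereal (f x) - ereal (\<beta> j + w j \<bullet> (x - p j))"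
              using j by (intro ereal_minus_mono SUP_upper order_refl)
            finally show ?thesis by simp
          qed
          moreover have "d > 0" using d(1) by simp
          ultimately show ?thesis by blast
        qed
      qed simp
    qed
  qed
qed

end
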